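(* Let $m\ge 2$ and consider the billiard on the torus $\mathbb{T}^m=\mathbb{R}^m/\mathbb{Z}^m$ with one small obstacle $O$. Assume that $O$ is contained in a closed ball of radius $r<\sqrt{2}/4$. Then the admissible rotation set $AR$ contains the closed ball of radius $(1-\sqrt{2}/2)\cos\eta(r)$ centered at $\mathbf{0}$, where $$\eta(r)=\sum_{n=0}^\infty\arcsin\frac{r}{2^{n-1}}.$$
   Context: Setting: the obstacle $O$ on $\mathbb{T}^m$ lifts to a family of pairwise disjoint sets $O_{\mathbf{k}}=O_{\mathbf{0}}+\mathbf{k}$, $\mathbf{k}\in\mathbb{Z}^m$, in $\mathbb{R}^m$, where $O_{\mathbf{0}}$ is compact, has nonempty interior and smooth boundary, and is strictly convex (convex, with boundary containing no straight line segment). $O$ is small if it is contained in a closed ball of radius smaller than $\sqrt{2}/4$ (the lifting is then chosen so that $O_{\mathbf{k}}$ is contained in such a ball centered at $\mathbf{k}$). Billiard trajectories move with unit speed along straight lines outside the interiors of the obstacles and reflect from obstacle boundaries with angle of incidence equal to angle of reflection; trajectories are lifted to $\mathbb{R}^m$, and the time along a trajectory piece equals its length. A tangency is not counted as a reflection. Admissibility: $O_{\mathbf{k}}$ is between $O_{\mathbf{i}}$ and $O_{\mathbf{j}}$ if $\mathbf{k}\ne\mathbf{i},\mathbf{j}$ and $O_{\mathbf{k}}$ intersects the convex hull of $O_{\mathbf{i}}\cup O_{\mathbf{j}}$. A (finite or infinite) sequence $(\mathbf{k}_n)_{n\ge 0}$ in $\mathbb{Z}^m$ is admissible if (1) $\mathbf{k}_0=\mathbf{0}$;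 (2) $\mathbf{k}_{n+1}\ne\mathbf{k}_n$ for every $n$; (3) for every $n$ there is no obstacle between $O_{\mathbf{k}_n}$ and $O_{\mathbf{k}_{n+1}}$; (4) for every $n$ the obstacle $O_{\mathbf{k}_{n+1}}$ is not between $O_{\mathbf{k}_n}$ and $O_{\mathbf{k}_{n+2}}$. A trajectory piece in $\mathbb{R}^m$ has type $(\mathbf{k}_n)_{n=0}^s$ if it starts on the boundary of $O_{\mathbf{k}_0}$, reflects consecutively from $O_{\mathbf{k}_1},\dots,O_{\mathbf{k}_{s-1}}$ and ends on the boundary of $O_{\mathbf{k}_s}$ (translating so that $\mathbf{k}_0=\mathbf{0}$). The admissible rotation set $AR$ is the set of all limits of sequences $((\mathbf{y}_n-\mathbf{x}_n)/t_n)_{n=1}^\infty$ such that there is a trajectory piece of admissible type in $\mathbb{R}^m$ from $\mathbf{x}_n$ to $\mathbf{y}_n$ of length $t_n$, and $t_n\to\infty$. *)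

theory Defs
  imports "HOL-Analysis.Analysis"
begin

primrec Ck_on :: "nat \<Rightarrow> 'a::euclidean_space set \<Rightarrow> ('a \<Rightarrow> real) \<Rightarrow> bool" where
  "Ck_on 0 U f \<longleftrightarrow> continuous_on U f"
| "Ck_on (Suc k) U f \<longleftrightarrow>
     (\<exists>f'. (\<forall>x\<in>U. (f has_derivative f' x) (at x)) \<and> (\<forall>v. Ck_on k U (\<lambda>x. f' x v)))"

definition smooth_on :: "'a::euclidean_space set \<Rightarrow> ('a \<Rightarrow> real) \<Rightarrow> bool" where
  "smooth_on U f \<longleftrightarrow> (\<forall>k. Ck_on k U f)"

text \<open>The boundary of \<open>S\<close> is smooth at \<open>q\<close> when \<open>S\<close> is, near \<open>q\<close>, a sublevel set of a
  \<open>C\<close>-infinity function whose gradient at \<open>q\<close> is nonzero; the normalized gradient is then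
  the outward unit normal at \<open>q\<close>.\<close>

definition defining_function_at ::
    "'a::euclidean_space set \<Rightarrow> 'a \<Rightarrow> ('a \<Rightarrow> real) \<Rightarrow> 'a \<Rightarrow> bool" where
  "defining_function_at S q f D \<longleftrightarrow>
     (\<exists>U. open U \<and> q \<in> U \<and> smooth_on U f \<and> S \<inter> U = {x \<in> U. f x \<le> 0}) \<and>
     f q = 0 \<and> (GDERIV f q :> D) \<and> D \<noteq> 0"

definition smooth_boundary :: "'a::euclidean_space set \<Rightarrow> bool" where
  "smooth_boundary S \<longleftrightarrow> (\<forall>q\<in>frontier S. \<exists>f D. defining_function_at S q f D)"

definition outward_unit_normal :: "'a::euclidean_space set \<Rightarrow> 'a \<Rightarrow> 'a \<Rightarrow> bool" where
  "outward_unit_normal S q \<nu> \<longleftrightarrow> (\<exists>f D. defining_function_at S q f D \<and> \<nu> = sgn D)"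

definition strictly_convex :: "'a::euclidean_space set \<Rightarrow> bool" where
  "strictly_convex S \<longleftrightarrow>
     convex S \<and> (\<forall>a b. a \<noteq> b \<longrightarrow> \<not> closed_segment a b \<subseteq> frontier S)"

definition obstacle :: "'a::euclidean_space set \<Rightarrow> bool" where
  "obstacle B \<longleftrightarrow>
     compact B \<and> interior B \<noteq> {} \<and> strictly_convex B \<and> smooth_boundary B"

text \<open>The billiard table on the torus is described by its lift: \<open>B\<close> is the obstacle with index
  \<open>0\<close> and \<open>lifted_obstacle B k\<close> is its translate by the integer vector \<open>k\<close>.\<close>

definition lifted_obstacle :: "(real ^ 'n) set \<Rightarrow> int ^ 'n \<Rightarrow> (real ^ 'n) set" where
  "lifted_obstacle B k = (\<lambda>x. x + (\<chi> i. of_int (k $ i))) ` B"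

definition obstacle_between ::
    "(real ^ 'n) set \<Rightarrow> int ^ 'n \<Rightarrow> int ^ 'n \<Rightarrow> int ^ 'n \<Rightarrow> bool" where
  "obstacle_between B k i j \<longleftrightarrow> k \<noteq> i \<and> k \<noteq> j \<and>
     lifted_obstacle B k \<inter> convex hull (lifted_obstacle B i \<union> lifted_obstacle B j) \<noteq> {}"

text \<open>A finite sequence \<open>k 0, \<dots>, k s\<close> is given by \<open>s\<close> and a function on \<open>nat\<close> whose values
  beyond \<open>s\<close> are irrelevant.\<close>

definition admissible :: "(real ^ 'n) set \<Rightarrow> nat \<Rightarrow> (nat \<Rightarrow> int ^ 'n) \<Rightarrow> bool" where
  "admissible B s k \<longleftrightarrow>
     k 0 = 0 \<and>
     (\<forall>n<s. k (Suc n) \<noteq> k n) \<and>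
     (\<forall>n<s. \<not> (\<exists>j. obstacle_between B j (k n) (k (Suc n)))) \<and>
     (\<forall>n. Suc n < s \<longrightarrow> \<not> obstacle_between B (k (Suc n)) (k n) (k (Suc (Suc n))))"

text \<open>Unit velocities \<open>v\<close> before and \<open>w\<close> after a reflection at \<open>q\<close>; the strict inequality
  excludes tangencies.\<close>

definition reflects_at :: "(real ^ 'n) set \<Rightarrow> real ^ 'n \<Rightarrow> real ^ 'n \<Rightarrow> real ^ 'n \<Rightarrow> bool" where
  "reflects_at S q v w \<longleftrightarrow>
     (\<exists>\<nu>. outward_unit_normal S q \<nu> \<and> v \<bullet> \<nu> < 0 \<and> w = v - (2 * (v \<bullet> \<nu>)) *\<^sub>R \<nu>)"

definition velocity :: "(nat \<Rightarrow> real ^ 'n) \<Rightarrow> nat \<Rightarrow> real ^ 'n" where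
  "velocity p i = sgn (p (Suc i) - p i)"

text \<open>A trajectory piece of type \<open>k 0, \<dots>, k s\<close> is given by its starting point \<open>p 0\<close>, its
  successive reflection points \<open>p 1, \<dots>, p (s - 1)\<close> and its endpoint \<open>p s\<close>. Its segments
  may touch further obstacles tangentially.\<close>

definition trajectory_piece ::
    "(real ^ 'n) set \<Rightarrow> nat \<Rightarrow> (nat \<Rightarrow> int ^ 'n) \<Rightarrow> (nat \<Rightarrow> real ^ 'n) \<Rightarrow> bool" where
  "trajectory_piece B s k p \<longleftrightarrow>
     (\<forall>i\<le>s. p i \<in> frontier (lifted_obstacle B (k i))) \<and>
     (\<forall>i<s. p i \<noteq> p (Suc i) \<and>
        (\<forall>j. closed_segment (p i) (p (Suc i)) \<inter> interior (lifted_obstacle B j) = {})) \<and>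
     (\<forall>i. Suc i < s \<longrightarrow>
        reflects_at (lifted_obstacle B (k (Suc i))) (p (Suc i)) (velocity p i) (velocity p (Suc i)))"

definition piece_length :: "nat \<Rightarrow> (nat \<Rightarrow> real ^ 'n) \<Rightarrow> real" where
  "piece_length s p = (\<Sum>i<s. dist (p i) (p (Suc i)))"

definition admissible_piece ::
    "(real ^ 'n) set \<Rightarrow> real ^ 'n \<Rightarrow> real ^ 'n \<Rightarrow> real \<Rightarrow> bool" where
  "admissible_piece B x y t \<longleftrightarrow>
     (\<exists>s k p. admissible B s k \<and> trajectory_piece B s k p \<and>
        p 0 = x \<and> p s = y \<and> piece_length s p = t)"

definition admissible_rotation_set :: "(real ^ 'n) set \<Rightarrow> (real ^ 'n) set" where
  "admissible_rotation_set B =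
     {w. \<exists>x y t. (\<forall>n::nat. admissible_piece B (x n) (y n) (t n)) \<and>
        filterlim t at_top sequentially \<and>
        (\<lambda>n. (y n - x n) /\<^sub>R t n) \<longlonglongrightarrow> w}"

definition eta :: "real \<Rightarrow> real" where
  "eta r = (\<Sum>n. arcsin (r / 2 powi (int n - 1)))"

end

theory Submission
  imports Defs
begin

text \<open>
  Trajectories are produced by minimization. Fix the obstacles \<open>O(k 0), \<dots>, O(k s)\<close> of an
  admissible type and take a shortest polygonal path that visits one point of each, in this order.
  The first-order condition at an inner vertex says that the sum of the two unit vectors pointing
  away from it is normal to the obstacle, which is the law of reflection; admissibility rules out
  the degenerate case in which the path goes straight on (\<open>shortest_is_trajectory_piece\<close>). So it
  suffices to produce admissible types and to estimate the lengths of their shortest paths.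

  A type is encoded by the list of its steps \<open>k (n + 1) - k n\<close>. Call a step \<open>x\<close> free if no obstacle
  lies between \<open>O(0)\<close> and \<open>O(x)\<close>. The smallness of the obstacle enters through one computation: if
  \<open>a\<close> and \<open>b\<close> have norm at least 1 and \<open>a \<bullet> b \<le> 0\<close>, then \<open>a\<close> is at distance at least
  \<open>sqrt 2 / 2 > 2 * r\<close> from the segment from 0 to \<open>a + b\<close>, so \<open>O(a)\<close> is not between \<open>O(0)\<close> and
  \<open>O(a + b)\<close>. Hence every list of free steps in which no two consecutive ones enclose an acute angle
  gives an admissible type (\<open>word_admissible\<close>). Such lists are called words. Any two words can be
  joined by inserting two unit steps, and a word with displacement \<open>d\<close> has travel time at most the
  sum of the norms of its steps. The travel time can also be increased by increments of at most 2, without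
  changing \<open>d\<close>, by appending steps \<open>e, - e\<close> (\<open>word_pad\<close>). Therefore a velocity \<open>z\<close> belongs to the
  rotation set as soon as for every time \<open>T\<close> there is a word with displacement \<open>T z\<close> and weight at
  most \<open>T\<close>, both up to a bounded error; these velocities form a convex set, called \<open>attainable\<close> below,
  and the closure of this set still lies in the rotation set.

  A free step \<open>a\<close> yields the attainable velocity \<open>(1 - sqrt 2 / 2) a / |a|\<close>: alternate \<open>a\<close> with unit
  steps \<open>e\<close> along the axes that point backwards, and mix the choices of \<open>e\<close> so that the result is
  parallel to \<open>a\<close> (\<open>attainable_free_direction\<close>). The estimate
  is tightest for \<open>a = (1, 1)\<close> in the plane.

  Finally, every lattice direction is within the angle \<open>eta r\<close> of a free step. If \<open>O(k)\<close> is between \<open>O(0)\<close> and \<open>O(x)\<close>, then \<open>k\<close>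
  is within \<open>2 * r\<close> of the segment from 0 to \<open>x\<close>, and so is \<open>x - k\<close>. The shorter one, \<open>y\<close>, satisfies
  \<open>2 |y| \<le> |x|\<close> and encloses with \<open>x\<close> an angle of at most \<open>arcsin (2 * r / |y|)\<close>. Iterate until a
  free step is reached: the norms, read backwards from the free step, are at least \<open>1, 2, 4, \<dots>\<close>, so the angles add
  up to at most \<open>eta r\<close> (\<open>free_direction_near_lattice_direction\<close>). Since lattice directions are dense,
  the support function of the attainable set is at least \<open>(1 - sqrt 2 / 2) * cos (eta r)\<close> in every
  direction, and a separating hyperplane shows that its closure contains the ball.
\<close>

section \<open>Integer vectors\<close>

definition embed :: "int ^ 'n \<Rightarrow> real ^ 'n" where
  "embed k = (\<chi> i. of_int (k $ i))"

lemma embed_nth [simp]: "embed k $ i = of_int (k $ i)"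
  by (simp add: embed_def)

lemma embed_0 [simp]: "embed 0 = 0"
  by (simp add: vec_eq_iff)

lemma embed_add [simp]: "embed (k + l) = embed k + embed l"
  by (simp add: vec_eq_iff)

lemma embed_diff [simp]: "embed (k - l) = embed k - embed l"
  by (simp add: vec_eq_iff)

lemma embed_minus [simp]: "embed (- k) = - embed k"
  by (simp add: vec_eq_iff)

lemma embed_eq_iff [simp]: "embed k = embed l \<longleftrightarrow> k = l"
  by (simp add: vec_eq_iff)

lemma embed_eq_0_iff [simp]: "embed k = 0 \<longleftrightarrow> k = 0"
  by (simp add: vec_eq_iff)

lemma inner_embed: "embed k \<bullet> embed l = of_int (\<Sum>i\<in>UNIV. k $ i * l $ i)"
  by (simp add: inner_vec_def)

lemma norm_embed_ge_1:
  assumes "k \<noteq> 0"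
  shows "norm (embed k) \<ge> 1"
proof -
  obtain i where "k $ i \<noteq> 0"
    using assms by (auto simp: vec_eq_iff)
  then have "1 \<le> \<bar>embed k $ i\<bar>"
    by simp
  also have "\<dots> \<le> norm (embed k)"
    by (rule component_le_norm_cart)
  finally show ?thesis .
qed

lemma norm_embed_diff_unit_segment_ge_1:
  fixes k :: "int ^ 'n" and e :: "int ^ 'n"
  assumes "e = axis i s" "\<bar>s\<bar> = 1" "k \<noteq> 0" "k \<noteq> e" "0 \<le> t" "t \<le> 1"
  shows "norm (embed k - t *\<^sub>R embed e) \<ge> 1"
proof (cases "\<exists>j. j \<noteq> i \<and> k $ j \<noteq> 0")
  case True
  then obtain j where j: "j \<noteq> i" "k $ j \<noteq> 0"
    by blast
  then have "1 \<le> \<bar>(embed k - t *\<^sub>R embed e) $ j\<bar>"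
    using assms(1) by (simp add: axis_def)
  then show ?thesis
    using component_le_norm_cart order_trans by blast
next
  case False
  then have *: "k $ j = 0" if "j \<noteq> i" for j
    using that by blast
  have "k $ i \<noteq> 0"
    using assms(3) * by (metis vec_eq_iff zero_index)
  moreover have "k $ i \<noteq> s"
  proof
    assume "k $ i = s"
    then have "k = axis i s"
      using * by (simp add: vec_eq_iff axis_def)
    then show False
      using assms(1,4) by simp
  qed
  moreover have "s = 1 \<or> s = -1"
    using assms(2) by linarith
  moreover have "(embed k - t *\<^sub>R embed e) $ i = of_int (k $ i) - t * of_int s"
    using assms(1) by (simp add: axis_def)
  moreover have "real_of_int (k $ i) \<ge> s + 1 \<or> real_of_int (k $ i) \<le> s - 1"
    "real_of_int (k $ i) \<ge> 1 \<or> real_of_int (k $ i) \<le> - 1"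
    using calculation(1,2) by linarith+
  ultimately have "1 \<le> \<bar>(embed k - t *\<^sub>R embed e) $ i\<bar>"
    using assms(5,6) by auto
  then show ?thesis
    using component_le_norm_cart order_trans by blast
qed

text \<open>With \<open>p = (1 - t) a\<close> and \<open>q = t b\<close> the vector in question is \<open>p - q\<close>, and an angle of at least
  90 degrees between \<open>a\<close> and \<open>b\<close> gives \<open>|p - q|\<^sup>2 \<ge> |p|\<^sup>2 + |q|\<^sup>2 \<ge> (1 - t)\<^sup>2 + t\<^sup>2 \<ge> 1/2\<close>.\<close>
lemma right_angle_far_from_segment:
  fixes a b :: "'a::real_inner"
  assumes "norm a \<ge> 1" "norm b \<ge> 1" "a \<bullet> b \<le> 0" "0 \<le> t" "t \<le> 1"
  shows "(norm (a - t *\<^sub>R (a + b)))\<^sup>2 \<ge> 1/2"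
proof -
  have "(norm (a - t *\<^sub>R (a + b)))\<^sup>2
      = (1-t)\<^sup>2 * (norm a)\<^sup>2 + t\<^sup>2 * (norm b)\<^sup>2 - 2 * (t * (1-t)) * (a \<bullet> b)"
    unfolding power2_norm_eq_inner
    by (simp add: inner_diff_left inner_diff_right inner_add_left inner_add_right inner_commute
        power2_eq_square algebra_simps)
  moreover have "(1-t)\<^sup>2 * (norm a)\<^sup>2 \<ge> (1-t)\<^sup>2 * 1" "t\<^sup>2 * (norm b)\<^sup>2 \<ge> t\<^sup>2 * 1"
    using assms by (intro mult_left_mono; simp)+
  moreover have "2 * (t * (1-t)) * (a \<bullet> b) \<le> 0"
    using assms by (intro mult_nonneg_nonpos) auto
  moreover have "(1-t)\<^sup>2 + t\<^sup>2 \<ge> 1/2"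
    using zero_le_power2[of "2*t - 1"] by (simp add: power2_eq_square algebra_simps)
  ultimately show ?thesis
    by linarith
qed

section \<open>Shortest paths obey the law of reflection\<close>

text \<open>The sum of the distances to \<open>a\<close> and \<open>b\<close> is a convex function, so its local minimum at an interior
  point is global; the global minimum \<open>dist a b\<close> is taken exactly on the segment. Convexity is used
  only along the line from \<open>q\<close> to \<open>a\<close>, where the value at \<open>a\<close> is already \<open>dist a b\<close>.\<close>
lemma interior_minimum_on_segment:
  fixes S :: "'a::euclidean_space set"
  assumes "q \<in> interior S"
    and min: "\<And>x. x \<in> S \<Longrightarrow> dist a q + dist q b \<le> dist a x + dist x b"
  shows "q \<in> closed_segment a b"
proof -
  obtain e where e: "e > 0" "ball q e \<subseteq> S"
    using assms(1) mem_interior by blast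
  define t where "t = min 1 (e / (2 * (norm (a - q) + 1)))"
  have t: "0 < t" "t \<le> 1"
    using e by (auto simp: t_def add_nonneg_pos)
  define x where "x = q + t *\<^sub>R (a - q)"
  have "t * norm (a - q) \<le> e / (2 * (norm (a - q) + 1)) * norm (a - q)"
    by (intro mult_right_mono) (auto simp: t_def)
  also have "\<dots> \<le> e / (2 * (norm (a - q) + 1)) * (norm (a - q) + 1)"
    using e by (intro mult_left_mono) (auto simp: add_nonneg_pos)
  also have "\<dots> = e / 2"
  proof -
    have "norm (a - q) + 1 \<noteq> 0"
      using norm_ge_zero[of "a - q"] by linarith
    then show ?thesis
      by (metis times_divide_eq_left mult.commute nonzero_mult_divide_mult_cancel_right)
  qed
  finally have "dist q x < e"
    using e t by (simp add: x_def dist_norm)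
  then have "dist a q + dist q b \<le> dist a x + dist x b"
    using e by (intro min) auto
  also have "dist a x = (1 - t) * dist a q"
  proof -
    have "a - x = (1 - t) *\<^sub>R (a - q)"
      by (simp add: x_def algebra_simps)
    then show ?thesis
      using t by (simp add: dist_norm)
  qed
  also have "dist x b \<le> (1 - t) * dist q b + t * dist a b"
  proof -
    have "x - b = (1 - t) *\<^sub>R (q - b) + t *\<^sub>R (a - b)"
      by (simp add: x_def algebra_simps)
    then have "norm (x - b) \<le> norm ((1 - t) *\<^sub>R (q - b)) + norm (t *\<^sub>R (a - b))"
      by (metis norm_triangle_ineq)
    then show ?thesis
      using t by (simp add: dist_norm)
  qed
  finally have "t * (dist a q + dist q b) \<le> t * dist a b"
    by (simp add: algebra_simps)
  then have "dist a q + dist q b \<le> dist a b"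
    using t by simp
  then have "dist a b = dist a q + dist q b"
    using dist_triangle[of a b q] by linarith
  then show ?thesis
    by (simp add: between between_mem_segment[symmetric])
qed

text \<open>Moving \<open>q\<close> into \<open>S\<close>, that is, in a direction \<open>h\<close> with \<open>D \<bullet> h < 0\<close>, cannot shorten the path.
  Hence \<open>g \<bullet> h \<ge> 0\<close> for the gradient \<open>g = v - w\<close> of the length, where \<open>v\<close> and \<open>w\<close> are the unit
  velocities before and after \<open>q\<close>. This forces \<open>w = v + \<mu> \<nu>\<close> with \<open>\<mu> \<ge> 0\<close> and the outward normal
  \<open>\<nu>\<close>, and then \<open>|v| = |w|\<close> leaves only \<open>\<mu> = - 2 (v \<bullet> \<nu>)\<close> or \<open>\<mu> = 0\<close>. In the second case the path
  would pass through \<open>q\<close> on a straight line.\<close>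
lemma minimum_reflects:
  fixes S :: "(real ^ 'n) set"
  assumes smooth: "defining_function_at S q f D" and q: "q \<noteq> a" "q \<noteq> b"
    and min: "\<And>x. x \<in> S \<Longrightarrow> dist a q + dist q b \<le> dist a x + dist x b"
    and off: "q \<notin> closed_segment a b"
  shows "reflects_at S q (sgn (q - a)) (sgn (b - q))"
proof -
  obtain U where U: "open U" "q \<in> U" "S \<inter> U = {x \<in> U. f x \<le> 0}"
    and f: "f q = 0" "GDERIV f q :> D" "D \<noteq> 0"
    using smooth unfolding defining_function_at_def by blast
  define v where "v = sgn (q - a)"
  define w where "w = sgn (b - q)"
  define g where "g = v - w"
  have n: "norm v = 1" "norm w = 1"
    using q by (simp_all add: v_def w_def norm_sgn)
  have dist_der: "((\<lambda>t. dist p (q + t *\<^sub>R h)) has_real_derivative (sgn (q - p) \<bullet> h)) (at 0)"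
    if "q \<noteq> p" for p h
  proof -
    have "((\<lambda>t. (q + t *\<^sub>R h) - p) has_derivative (\<lambda>t. t *\<^sub>R h)) (at 0)"
      by (auto intro!: derivative_eq_intros)
    moreover have "(norm has_derivative (\<lambda>y. y \<bullet> sgn (q - p))) (at ((q + 0 *\<^sub>R h) - p))"
      using has_derivative_norm[of "q - p"] that by simp
    ultimately have "((\<lambda>t. norm ((q + t *\<^sub>R h) - p)) has_derivative
        (\<lambda>t. (t *\<^sub>R h) \<bullet> sgn (q - p))) (at 0)"
      by (rule has_derivative_compose)
    then show ?thesis
      by (simp add: has_field_derivative_def dist_norm norm_minus_commute inner_commute
          mult_commute_abs)
  qed
  have first_order: "g \<bullet> h \<ge> 0" if h: "D \<bullet> h < 0" for h
  proof (rule ccontr)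
    assume neg: "\<not> g \<bullet> h \<ge> 0"
    have "((\<lambda>t. dist a (q + t *\<^sub>R h) + dist b (q + t *\<^sub>R h)) has_real_derivative
        (sgn (q - a) \<bullet> h + sgn (q - b) \<bullet> h)) (at 0)"
      by (intro DERIV_add dist_der q)
    moreover have "sgn (q - a) \<bullet> h + sgn (q - b) \<bullet> h = g \<bullet> h"
      using sgn_minus[of "b - q"] by (simp add: g_def v_def w_def inner_diff_left)
    ultimately have F: "((\<lambda>t. dist a (q + t *\<^sub>R h) + dist b (q + t *\<^sub>R h))
        has_real_derivative (g \<bullet> h)) (at 0)"
      by simp
    obtain d1 where d1: "d1 > 0" "\<And>t. 0 < t \<Longrightarrow> t < d1 \<Longrightarrow>
        dist a (q + t *\<^sub>R h) + dist b (q + t *\<^sub>R h) < dist a q + dist b q"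
      using DERIV_neg_dec_right[OF F] neg by auto
    have "((\<lambda>t. q + t *\<^sub>R h) has_derivative (\<lambda>t. t *\<^sub>R h)) (at 0)"
      by (auto intro!: derivative_eq_intros)
    moreover have "(f has_derivative (\<lambda>y. y \<bullet> D)) (at (q + 0 *\<^sub>R h))"
      using f(2) by (simp add: gderiv_def)
    ultimately have "((\<lambda>t. f (q + t *\<^sub>R h)) has_derivative (\<lambda>t. (t *\<^sub>R h) \<bullet> D)) (at 0)"
      by (rule has_derivative_compose)
    then have G: "((\<lambda>t. f (q + t *\<^sub>R h)) has_real_derivative (D \<bullet> h)) (at 0)"
      by (simp add: has_field_derivative_def inner_commute mult_commute_abs)
    obtain d2 where d2: "d2 > 0" "\<And>t. 0 < t \<Longrightarrow> t < d2 \<Longrightarrow> f (q + t *\<^sub>R h) < 0"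
      using DERIV_neg_dec_right[OF G] h f(1) by auto
    have "continuous (at 0) (\<lambda>t. q + t *\<^sub>R h)"
      by (intro continuous_intros)
    then have "\<forall>\<^sub>F t in at 0. q + t *\<^sub>R h \<in> U"
      using U(1,2) unfolding continuous_within by (intro topological_tendstoD) auto
    then obtain d3 where d3: "d3 > 0" "\<And>t. t \<noteq> 0 \<Longrightarrow> dist t 0 < d3 \<Longrightarrow> q + t *\<^sub>R h \<in> U"
      unfolding eventually_at by auto
    define t where "t = min d1 (min d2 d3) / 2"
    have t: "0 < t" "t < d1" "t < d2" "t < d3"
      unfolding t_def using d1(1) d2(1) d3(1) by linarith+
    have "q + t *\<^sub>R h \<in> U" "f (q + t *\<^sub>R h) \<le> 0"
      using d2(2)[of t] d3(2)[of t] t by simp_all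
    then have "q + t *\<^sub>R h \<in> S"
      using U(3) by blast
    then show False
      using min[of "q + t *\<^sub>R h"] d1(2)[of t] t by (simp add: dist_commute)
  qed
  \<comment> \<open>The part \<open>h\<close> of \<open>g\<close> orthogonal to \<open>D\<close> vanishes: test \<open>first_order\<close> with \<open>- h\<close>, tilted slightly
    towards the side on which \<open>D\<close> is negative.\<close>
  define \<nu> where "\<nu> = sgn D"
  have \<nu>: "\<nu> \<bullet> \<nu> = 1" "D = norm D *\<^sub>R \<nu>"
    using f(3) by (simp_all add: \<nu>_def dot_square_norm norm_sgn sgn_div_norm)
  define h where "h = g - (g \<bullet> \<nu>) *\<^sub>R \<nu>"
  have h\<nu>: "h \<bullet> \<nu> = 0"
    by (simp add: h_def inner_diff_left \<nu>)
  have hg: "h \<bullet> g = h \<bullet> h"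
    using h\<nu> by (simp add: h_def inner_diff_right inner_commute)
  have D\<nu>: "D \<bullet> x = norm D * (\<nu> \<bullet> x)" for x
    by (subst \<nu>(2)) simp
  have small: "h \<bullet> h \<le> \<epsilon> * - (g \<bullet> \<nu>)" if "\<epsilon> > 0" for \<epsilon>
  proof -
    have "D \<bullet> (- h - \<epsilon> *\<^sub>R \<nu>) < 0"
      unfolding D\<nu> using that f(3) h\<nu> \<nu> by (simp add: inner_diff_right inner_commute)
    from first_order[OF this] show ?thesis
      using hg by (simp add: inner_diff_right inner_commute)
  qed
  have "h \<bullet> h \<le> 0"
  proof (rule ccontr)
    assume "\<not> h \<bullet> h \<le> 0"
    then have pos: "h \<bullet> h > 0"
      by linarith
    moreover have "h \<bullet> h \<le> - (g \<bullet> \<nu>)"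
      using small[of 1] by simp
    ultimately have "- (g \<bullet> \<nu>) > 0"
      by linarith
    with small[of "(h \<bullet> h) / (2 * - (g \<bullet> \<nu>))"] pos show False
      by (simp add: field_simps)
  qed
  then have "h = 0"
    by (metis antisym inner_eq_zero_iff inner_ge_zero)
  define \<mu> where "\<mu> = - (g \<bullet> \<nu>)"
  have w: "w = v + \<mu> *\<^sub>R \<nu>"
    using \<open>h = 0\<close> by (simp add: h_def g_def \<mu>_def algebra_simps)
  have "\<mu> \<ge> 0"
    using small[of 1] \<open>h = 0\<close> by (simp add: \<mu>_def)
  have "\<mu> \<noteq> 0"
  proof
    assume "\<mu> = 0"
    then have "v = w"
      using w by simp
    have "q - a = norm (q - a) *\<^sub>R v" "b - q = norm (b - q) *\<^sub>R w"
      using q by (simp_all add: v_def w_def sgn_div_norm)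
    then have "norm (q - a) *\<^sub>R (b - q) = norm (b - q) *\<^sub>R (q - a)"
      using \<open>v = w\<close> by (metis mult.commute scaleR_scaleR)
    then have "dist a b = dist a q + dist q b"
      by (simp add: dist_triangle_eq norm_minus_commute)
        (metis minus_diff_eq norm_minus_commute scaleR_minus_right)
    then show False
      using off by (simp add: between between_mem_segment[symmetric])
  qed
  have "w \<bullet> w = v \<bullet> v + 2 * \<mu> * (v \<bullet> \<nu>) + \<mu>\<^sup>2"
    by (simp add: w inner_add_left inner_add_right inner_commute \<nu> power2_eq_square)
  then have "\<mu> * (2 * (v \<bullet> \<nu>) + \<mu>) = 0"
    using n by (simp add: dot_square_norm power2_eq_square algebra_simps)
  then have "\<mu> = - (2 * (v \<bullet> \<nu>))"
    using \<open>\<mu> \<noteq> 0\<close> by simp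
  moreover have "outward_unit_normal S q \<nu>"
    unfolding outward_unit_normal_def \<nu>_def using smooth by blast
  ultimately show ?thesis
    unfolding reflects_at_def v_def[symmetric] w_def[symmetric]
    using w \<open>\<mu> \<ge> 0\<close> \<open>\<mu> \<noteq> 0\<close> by (intro exI[of _ \<nu>]) auto
qed

section \<open>The lifted obstacles\<close>

lemma mem_translation: "x \<in> (+) a ` S \<longleftrightarrow> x - a \<in> S" for a :: "'a::ab_group_add"
proof
  assume "x - a \<in> S"
  then have "a + (x - a) \<in> (+) a ` S"
    by (rule imageI)
  then show "x \<in> (+) a ` S"
    by simp
qed auto

locale small_obstacle =
  fixes B :: "(real ^ 'n) set" and c :: "real ^ 'n" and r :: real
  assumes dim: "CARD('n) \<ge> 2"
    and obstacle: "obstacle B"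
    and ball: "B \<subseteq> cball c r"
    and small: "r < sqrt 2 / 4"
begin

lemma r_nonneg: "r \<ge> 0"
proof -
  obtain x where "x \<in> B"
    using obstacle interior_subset unfolding obstacle_def by blast
  then have "dist c x \<le> r"
    using ball by auto
  then show ?thesis
    using zero_le_dist order_trans by blast
qed

lemma two_r_sq: "(2 * r)\<^sup>2 < 1/2"
proof -
  have "(2 * r)\<^sup>2 < (sqrt 2 / 2)\<^sup>2"
    using small r_nonneg by (intro power_strict_mono) auto
  then show ?thesis
    by (simp add: power_divide)
qed

lemma two_r_less_1: "2 * r < 1"
  using two_r_sq abs_square_less_1[of "2 * r"] by linarith

lemma B_facts: "compact B" "convex B" "smooth_boundary B" "B \<noteq> {}"
  using obstacle interior_subset unfolding obstacle_def strictly_convex_def by blast+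

abbreviation obs :: "int ^ 'n \<Rightarrow> (real ^ 'n) set" where
  "obs \<equiv> lifted_obstacle B"

lemma obs_eq: "obs k = (+) (embed k) ` B"
  by (simp add: lifted_obstacle_def embed_def add.commute)

lemma obs_shift: "obs (k + l) = (+) (embed l) ` obs k"
  by (simp add: obs_eq image_image algebra_simps)

lemma mem_obs: "x \<in> obs k \<longleftrightarrow> x - embed k \<in> B"
  by (simp add: obs_eq mem_translation)

lemma obs_facts: "compact (obs k)" "convex (obs k)" "obs k \<noteq> {}" "closed (obs k)"
  using B_facts by (auto simp: obs_eq compact_translation convex_translation compact_imp_closed)

lemma obs_near: "x \<in> obs k \<Longrightarrow> norm (x - (c + embed k)) \<le> r"
  using ball by (auto simp: mem_obs dist_norm norm_minus_commute algebra_simps)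

lemma dist_obs_ge:
  assumes "x \<in> obs k" "y \<in> obs l" "k \<noteq> l"
  shows "dist x y \<ge> 1 - 2 * r"
proof -
  have "1 \<le> norm (embed (k - l))"
    using assms(3) by (intro norm_embed_ge_1) simp
  also have "embed (k - l) = (x - y) - (x - (c + embed k)) + (y - (c + embed l))"
    by simp
  also have "norm \<dots> \<le> norm (x - y) + norm (x - (c + embed k)) + norm (y - (c + embed l))"
    using norm_triangle_ineq norm_triangle_ineq4 by (smt (verit))
  finally show ?thesis
    using obs_near[OF assms(1)] obs_near[OF assms(2)] by (simp add: dist_norm)
qed

lemma obs_disjoint: "x \<in> obs k \<Longrightarrow> x \<in> obs l \<Longrightarrow> k = l"
  using dist_obs_ge[of x k x l] two_r_less_1 by auto

text \<open>Since smoothness is defined by recursion on the order of differentiability, its invariance under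
  translations needs an induction.\<close>
lemma defining_function_at_obs:
  assumes "defining_function_at B q f D"
  shows "defining_function_at (obs k) (q + embed k) (\<lambda>x. f (x - embed k)) D"
proof -
  obtain U where U: "open U" "q \<in> U" "smooth_on U f" "B \<inter> U = {x \<in> U. f x \<le> 0}"
    and f: "f q = 0" "GDERIV f q :> D" "D \<noteq> 0"
    using assms unfolding defining_function_at_def by blast
  have Ck: "Ck_on n ((+) (embed k) ` U) (\<lambda>x. g (x - embed k))" if "Ck_on n U g" for n g
    using that
  proof (induction n arbitrary: g)
    case 0
    then show ?case
      by (auto intro!: continuous_on_compose2[of U g] continuous_intros)
  next
    case (Suc n)
    then obtain g' where g': "\<forall>x\<in>U. (g has_derivative g' x) (at x)" "\<forall>v. Ck_on n U (\<lambda>x. g' x v)"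
      by auto
    have "((\<lambda>x. g (x - embed k)) has_derivative g' (x - embed k)) (at x)"
      if "x \<in> (+) (embed k) ` U" for x
    proof -
      have "((\<lambda>x. x - embed k) has_derivative (\<lambda>h. h)) (at x)"
        by (auto intro!: derivative_eq_intros)
      moreover have "(g has_derivative g' (x - embed k)) (at (x - embed k))"
        using that g' by auto
      ultimately show ?thesis
        using has_derivative_compose by blast
    qed
    moreover have "\<forall>v. Ck_on n ((+) (embed k) ` U) (\<lambda>x. g' (x - embed k) v)"
      using g'(2) Suc.IH[of "\<lambda>x. g' x v" for v] by blast
    ultimately show ?case
      by (auto intro!: exI[of _ "\<lambda>x. g' (x - embed k)"])
  qed
  have "open ((+) (embed k) ` U)"
    using U(1) by (rule open_translation)
  moreover have "smooth_on ((+) (embed k) ` U) (\<lambda>x. f (x - embed k))"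
    using U(3) Ck by (simp add: smooth_on_def)
  moreover have "obs k \<inter> (+) (embed k) ` U = {x \<in> (+) (embed k) ` U. f (x - embed k) \<le> 0}"
    using U(4) by (simp add: set_eq_iff mem_obs mem_translation)
  moreover have "GDERIV (\<lambda>x. f (x - embed k)) (q + embed k) :> D"
  proof -
    have "((\<lambda>x. x - embed k) has_derivative (\<lambda>h. h)) (at (q + embed k))"
      by (auto intro!: derivative_eq_intros)
    moreover have "(f has_derivative (\<lambda>h. h \<bullet> D)) (at ((q + embed k) - embed k))"
      using f(2) by (simp add: gderiv_def)
    ultimately show ?thesis
      unfolding gderiv_def using has_derivative_compose by blast
  qed
  moreover have "q + embed k \<in> (+) (embed k) ` U"
    using U(2) by (simp add: mem_translation)
  ultimately show ?thesis
    unfolding defining_function_at_def using f by (auto intro!: exI[of _ "(+) (embed k) ` U"])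
qed

lemma obs_has_normal:
  assumes "q \<in> frontier (obs k)"
  obtains f D where "defining_function_at (obs k) q f D"
proof -
  have "frontier (obs k) = (+) (embed k) ` frontier B"
    by (simp add: obs_eq frontier_def closure_translation interior_translation translation_diff)
  then obtain q0 where q0: "q0 \<in> frontier B" "q = q0 + embed k"
    using assms by (auto simp: add.commute)
  then show ?thesis
    using that defining_function_at_obs B_facts(3) unfolding smooth_boundary_def by blast
qed

text \<open>Paths that visit the obstacles \<open>k 0, k 1, \<dots>\<close>; only the first \<open>s\<close> legs count for the
  length, the later points are there to make the set of paths a product of compact sets.\<close>
definition visits :: "(nat \<Rightarrow> int ^ 'n) \<Rightarrow> (nat \<Rightarrow> real ^ 'n) \<Rightarrow> bool" where
  "visits k p \<longleftrightarrow> (\<forall>i. p i \<in> obs (k i))"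

definition shortest :: "nat \<Rightarrow> (nat \<Rightarrow> int ^ 'n) \<Rightarrow> (nat \<Rightarrow> real ^ 'n) \<Rightarrow> bool" where
  "shortest s k p \<longleftrightarrow> visits k p \<and> (\<forall>q. visits k q \<longrightarrow> piece_length s p \<le> piece_length s q)"

lemma shortest_exists: "\<exists>p. shortest s k p"
proof -
  have "{p. visits k p} = PiE UNIV (\<lambda>i. obs (k i))"
    by (auto simp: visits_def PiE_def)
  moreover have "compactin (product_topology (\<lambda>i. euclidean) UNIV) (PiE UNIV (\<lambda>i. obs (k i)))"
    using obs_facts(1) by (simp add: compactin_PiE)
  ultimately have "compact {p. visits k p}"
    by (simp add: euclidean_product_topology)
  moreover have "{p. visits k p} \<noteq> {}"
  proof -
    obtain b where "b \<in> B"
      using B_facts by blast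
    then have "visits k (\<lambda>i. embed (k i) + b)"
      by (auto simp: visits_def obs_eq)
    then show ?thesis
      by blast
  qed
  moreover have "continuous_on {p. visits k p} (piece_length s)"
  proof -
    have "continuous_on UNIV (\<lambda>p. \<Sum>i<s. dist (p i) (p (Suc i) :: real ^ 'n))"
      by (intro continuous_intros continuous_on_product_coordinates)
    then show ?thesis
      unfolding piece_length_def[abs_def] using continuous_on_subset by blast
  qed
  ultimately show ?thesis
    using continuous_attains_inf[of "{p. visits k p}" "piece_length s"]
    unfolding shortest_def by auto
qed

text \<open>The part of the length of a path that depends on its vertex \<open>i\<close>, as a function of the position
  \<open>y\<close> of this vertex.\<close>
definition legs_at :: "nat \<Rightarrow> (nat \<Rightarrow> real ^ 'n) \<Rightarrow> nat \<Rightarrow> real ^ 'n \<Rightarrow> real" where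
  "legs_at s p i y =
     (if i = 0 then 0 else dist (p (i - 1)) y) + (if i < s then dist y (p (Suc i)) else 0)"

lemma piece_length_Suc [simp]: "piece_length (Suc s) p = piece_length s p + dist (p s) (p (Suc s))"
  by (simp add: piece_length_def)

lemma piece_length_0 [simp]: "piece_length 0 p = 0"
  by (simp add: piece_length_def)

lemma piece_length_upd_beyond: "s < i \<Longrightarrow> piece_length s (p(i := y)) = piece_length s p"
  by (auto simp: piece_length_def intro!: sum.cong)

lemma piece_length_upd:
  "i \<le> s \<Longrightarrow> piece_length s (p(i := y)) + legs_at s p i (p i) = piece_length s p + legs_at s p i y"
proof (induction s)
  case 0
  then show ?case
    by (simp add: legs_at_def)
next
  case (Suc s)
  show ?case
  proof (cases "i = Suc s")
    case True
    then have "piece_length s (p(i := y)) = piece_length s p"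
      by (intro piece_length_upd_beyond) simp
    moreover have "(p(i := y)) s = p s" "(p(i := y)) (Suc s) = y"
      using True by simp_all
    ultimately show ?thesis
      using True unfolding legs_at_def piece_length_Suc by simp
  next
    case False
    with Suc.prems have "i \<le> s"
      by simp
    note Suc.IH[OF this]
    moreover have "legs_at (Suc s) p i x
        = legs_at s p i x + (if i = s then dist x (p (Suc s)) else 0)" for x
      using False Suc.prems by (auto simp: legs_at_def)
    moreover have "piece_length (Suc s) (p(i := y))
        = piece_length s (p(i := y)) + (if i = s then dist y (p (Suc s)) else dist (p s) (p (Suc s)))"
      using False by (subst piece_length_Suc) simp
    moreover note piece_length_Suc[of s p]
    ultimately show ?thesis
      by (cases "i = s") simp_all
  qed
qed

lemma visits_upd: "visits k p \<Longrightarrow> y \<in> obs (k i) \<Longrightarrow> visits k (p(i := y))"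
  by (simp add: visits_def)

lemma shortest_legs_le:
  assumes "shortest s k p" "i \<le> s" "y \<in> obs (k i)"
  shows "legs_at s p i (p i) \<le> legs_at s p i y"
proof -
  have "piece_length s p \<le> piece_length s (p(i := y))"
    using assms visits_upd unfolding shortest_def by blast
  then show ?thesis
    using piece_length_upd[OF assms(2), of p y] by linarith
qed

lemma shortest_upd:
  assumes "shortest s k p" "i \<le> s" "y \<in> obs (k i)" "legs_at s p i y \<le> legs_at s p i (p i)"
  shows "shortest s k (p(i := y))"
proof -
  have "piece_length s (p(i := y)) \<le> piece_length s p"
    using piece_length_upd[OF assms(2), of p y] assms(4) by linarith
  then show ?thesis
    using assms visits_upd unfolding shortest_def by (meson order_trans)
qed

lemma segment_in_hull:
  assumes "x \<in> obs k" "y \<in> obs l"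
  shows "closed_segment x y \<subseteq> convex hull (obs k \<union> obs l)"
  using assms by (intro closed_segment_subset_convex_hull hull_inc) auto

context
  fixes s k
  assumes adm: "admissible B s k" and s: "0 < s"
begin

text \<open>Otherwise the vertex would lie in the convex hull of the neighbouring obstacles, so its own obstacle
  would be between them, which is excluded for admissible types.\<close>
lemma mid_not_on_segment:
  assumes "visits k p" "Suc i < s"
  shows "p (Suc i) \<notin> closed_segment (p i) (p (Suc (Suc i)))"
proof
  assume "p (Suc i) \<in> closed_segment (p i) (p (Suc (Suc i)))"
  then have "p (Suc i) \<in> convex hull (obs (k i) \<union> obs (k (Suc (Suc i))))"
    using segment_in_hull assms(1) unfolding visits_def by blast
  moreover have "p (Suc i) \<in> obs (k (Suc i))"
    using assms(1) unfolding visits_def by blast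
  moreover have "k (Suc i) \<noteq> k i" "k (Suc i) \<noteq> k (Suc (Suc i))"
    using adm assms(2) unfolding admissible_def by (metis Suc_lessD)+
  ultimately have "obstacle_between B (k (Suc i)) (k i) (k (Suc (Suc i)))"
    unfolding obstacle_between_def by blast
  then show False
    using adm assms(2) unfolding admissible_def by blast
qed

lemma consecutive_points_differ:
  assumes "visits k p" "i < s"
  shows "p i \<noteq> p (Suc i)"
proof
  assume "p i = p (Suc i)"
  then have "k i = k (Suc i)"
    using assms(1) obs_disjoint[of "p i" "k i" "k (Suc i)"] unfolding visits_def by metis
  then show False
    using adm assms(2) unfolding admissible_def by metis
qed

text \<open>A vertex in the interior of its obstacle could be moved freely, so it would lie on the segment
  between its neighbours. An end point of the path has just one neighbour \<open>q\<close>, which then plays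
  the role of both.\<close>
lemma shortest_in_frontier:
  assumes p: "shortest s k p" and i: "i \<le> s"
  shows "p i \<in> frontier (obs (k i))"
proof (rule ccontr)
  assume "p i \<notin> frontier (obs (k i))"
  moreover have v: "visits k p" and pi: "p i \<in> obs (k i)"
    using p unfolding shortest_def visits_def by blast+
  ultimately have int: "p i \<in> interior (obs (k i))"
    using closure_subset by (auto simp: frontier_def)
  have end_point: False if "q \<noteq> p i" "\<And>x. legs_at s p i x = dist q x" for q
  proof -
    have "p i \<in> closed_segment q q"
    proof (rule interior_minimum_on_segment[OF int])
      fix x
      assume "x \<in> obs (k i)"
      from shortest_legs_le[OF p i this] have "dist q (p i) \<le> dist q x"
        using that(2) by simp
      then show "dist q (p i) + dist (p i) q \<le> dist q x + dist x q"
        using dist_commute[of q "p i"] dist_commute[of q x] by linarith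
    qed
    then show False
      using that(1) by simp
  qed
  consider "i = 0" | "i = s" | "0 < i" "i < s"
    using i by linarith
  then show False
  proof cases
    case 1
    then show False
      using s consecutive_points_differ[OF v, of 0]
      by (intro end_point[of "p 1"]) (auto simp: legs_at_def dist_commute)
  next
    case 2
    then show False
      using s consecutive_points_differ[OF v, of "s - 1"]
      by (intro end_point[of "p (s - 1)"]) (auto simp: legs_at_def)
  next
    case 3
    then obtain j where j: "i = Suc j"
      by (metis gr0_conv_Suc)
    have "p i \<in> closed_segment (p j) (p (Suc i))"
    proof (rule interior_minimum_on_segment[OF int])
      fix x
      assume "x \<in> obs (k i)"
      from shortest_legs_le[OF p i this]
      show "dist (p j) (p i) + dist (p i) (p (Suc i)) \<le> dist (p j) x + dist x (p (Suc i))"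
        using 3 by (simp add: legs_at_def j)
    qed
    then show False
      using mid_not_on_segment[OF v] 3 by (simp add: j)
  qed
qed

text \<open>Sliding a vertex along its leg to \<open>y\<close> does not lengthen the path, so the new path is again
  shortest and its vertices are again on the frontiers.\<close>
lemma shortest_not_through_own_interior:
  assumes p: "shortest s k p" and i: "i < s" and y: "y \<in> closed_segment (p i) (p (Suc i))"
  shows "y \<notin> interior (obs (k i))" "y \<notin> interior (obs (k (Suc i)))"
proof -
  have d: "dist (p i) (p (Suc i)) = dist (p i) y + dist y (p (Suc i))"
    using y by (simp add: between between_mem_segment[symmetric])
  show "y \<notin> interior (obs (k i))"
  proof
    assume int: "y \<in> interior (obs (k i))"
    then have "y \<in> obs (k i)"
      using interior_subset by blast
    moreover have "legs_at s p i y \<le> legs_at s p i (p i)"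
      using i d dist_triangle[of "p (i - 1)" y "p i"] by (simp add: legs_at_def)
    ultimately have "shortest s k (p(i := y))"
      using shortest_upd p i by simp
    from shortest_in_frontier[OF this, of i] show False
      using int i by (simp add: frontier_def)
  qed
  show "y \<notin> interior (obs (k (Suc i)))"
  proof
    assume int: "y \<in> interior (obs (k (Suc i)))"
    then have "y \<in> obs (k (Suc i))"
      using interior_subset by blast
    moreover have "legs_at s p (Suc i) y \<le> legs_at s p (Suc i) (p (Suc i))"
      using i d dist_triangle[of y "p (Suc (Suc i))" "p (Suc i)"] by (simp add: legs_at_def)
    ultimately have "shortest s k (p(Suc i := y))"
      using shortest_upd p i by simp
    from shortest_in_frontier[OF this, of "Suc i"] show False
      using int i by (simp add: frontier_def)
  qed
qed

lemma shortest_is_trajectory_piece: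
  assumes p: "shortest s k p"
  shows "trajectory_piece B s k p"
  unfolding trajectory_piece_def
proof (intro conjI allI impI)
  have v: "visits k p"
    using p unfolding shortest_def by blast
  show "p i \<in> frontier (obs (k i))" if "i \<le> s" for i
    using shortest_in_frontier[OF p that] .
  show "p i \<noteq> p (Suc i)" if "i < s" for i
    using consecutive_points_differ[OF v that] .
  show "closed_segment (p i) (p (Suc i)) \<inter> interior (obs j) = {}" if i: "i < s" for i j
  proof (cases "j = k i \<or> j = k (Suc i)")
    case True
    then show ?thesis
      using shortest_not_through_own_interior[OF p i] by blast
  next
    case False
    have "\<not> obstacle_between B j (k i) (k (Suc i))"
      using adm i unfolding admissible_def by blast
    with False have "obs j \<inter> convex hull (obs (k i) \<union> obs (k (Suc i))) = {}"
      unfolding obstacle_between_def by blast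
    moreover have "closed_segment (p i) (p (Suc i)) \<subseteq> convex hull (obs (k i) \<union> obs (k (Suc i)))"
      using v unfolding visits_def by (intro segment_in_hull) auto
    ultimately show ?thesis
      using interior_subset by blast
  qed
  show "reflects_at (obs (k (Suc i))) (p (Suc i)) (velocity p i) (velocity p (Suc i))"
    if i: "Suc i < s" for i
  proof -
    obtain f D where "defining_function_at (obs (k (Suc i))) (p (Suc i)) f D"
      using obs_has_normal shortest_in_frontier[OF p, of "Suc i"] i by (metis less_imp_le)
    then show ?thesis
      unfolding velocity_def
    proof (rule minimum_reflects)
      show "p (Suc i) \<noteq> p i" "p (Suc i) \<noteq> p (Suc (Suc i))"
        using consecutive_points_differ[OF v] i by (metis Suc_lessD)+
      show "p (Suc i) \<notin> closed_segment (p i) (p (Suc (Suc i)))"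
        using mid_not_on_segment[OF v i] .
      show "dist (p i) (p (Suc i)) + dist (p (Suc i)) (p (Suc (Suc i)))
          \<le> dist (p i) x + dist x (p (Suc (Suc i)))" if "x \<in> obs (k (Suc i))" for x
        using shortest_legs_le[OF p less_imp_le[OF i] that] i by (simp add: legs_at_def)
    qed
  qed
qed

end

end

section \<open>Words of steps\<close>

context small_obstacle
begin

lemma obstacle_between_shift:
  "obstacle_between B (k + l) (i + l) (j + l) \<longleftrightarrow> obstacle_between B k i j"
proof -
  have "obs (k + l) \<inter> convex hull (obs (i + l) \<union> obs (j + l))
      = (+) (embed l) ` (obs k \<inter> convex hull (obs i \<union> obs j))"
    by (simp add: obs_shift image_Un[symmetric] convex_hull_translation image_Int[symmetric]
        inj_on_def)
  then show ?thesis
    by (simp add: obstacle_between_def)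
qed

text \<open>Both \<open>O(k)\<close> and the convex hull of \<open>O(i)\<close> and \<open>O(j)\<close> stay within \<open>r\<close> of their cores, which are,
  relative to \<open>c\<close>, the point \<open>k\<close> and the segment from \<open>i\<close> to \<open>j\<close>. If they meet, the cores are
  within \<open>2 * r\<close> of each other.\<close>
lemma between_near_chord:
  assumes "obstacle_between B k i j"
  obtains t where "0 \<le> t" "t \<le> 1" "norm (embed (k - i) - t *\<^sub>R embed (j - i)) \<le> 2 * r"
proof -
  obtain q where q: "q \<in> obs k" "q \<in> convex hull (obs i \<union> obs j)"
    using assms unfolding obstacle_between_def by blast
  then obtain u t x y where ut: "0 \<le> u" "0 \<le> t" "u + t = 1"
    and xy: "x \<in> obs i" "y \<in> obs j" "q = u *\<^sub>R x + t *\<^sub>R y"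
    by (auto simp: convex_hull_union_two obs_facts)
  have u: "u = 1 - t"
    using ut by simp
  have "embed (k - i) - t *\<^sub>R embed (j - i)
      = (u *\<^sub>R (x - (c + embed i)) + t *\<^sub>R (y - (c + embed j))) - (q - (c + embed k))"
    by (simp add: xy u algebra_simps)
  also have "norm \<dots> \<le> (norm (u *\<^sub>R (x - (c + embed i))) + norm (t *\<^sub>R (y - (c + embed j))))
      + norm (q - (c + embed k))"
    by (intro order_trans[OF norm_triangle_ineq4] add_right_mono norm_triangle_ineq)
  also have "\<dots> \<le> (u * r + t * r) + r"
    using ut obs_near[OF xy(1)] obs_near[OF xy(2)] obs_near[OF q(1)]
    by (intro add_mono) (simp_all add: mult_left_mono)
  also have "\<dots> = 2 * r"
    using ut by (simp add: distrib_right[symmetric])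
  finally show ?thesis
    using ut by (intro that[of t]) auto
qed

definition free :: "int ^ 'n \<Rightarrow> bool" where
  "free x \<longleftrightarrow> x \<noteq> 0 \<and> (\<forall>j. \<not> obstacle_between B j 0 x)"

text \<open>A condition on the steps alone that implies admissibility: a turn by at least 90 degrees keeps the
  obstacle at which it happens out of the convex hull of the two neighbouring obstacles.\<close>
definition word :: "(int ^ 'n) list \<Rightarrow> bool" where
  "word W \<longleftrightarrow> (\<forall>x\<in>set W. free x) \<and> successively (\<lambda>a b. embed a \<bullet> embed b \<le> 0) W"

definition stops :: "(int ^ 'n) list \<Rightarrow> nat \<Rightarrow> int ^ 'n" where
  "stops W n = sum_list (take n W)"

lemma stops_Suc: "n < length W \<Longrightarrow> stops W (Suc n) = stops W n + W ! n"
  by (simp add: stops_def take_Suc_conv_app_nth)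

lemma turn_unobstructed:
  assumes "a \<noteq> 0" "b \<noteq> 0" "embed a \<bullet> embed b \<le> 0"
  shows "\<not> obstacle_between B (i + a) i (i + a + b)"
proof
  assume "obstacle_between B (i + a) i (i + a + b)"
  then obtain t where t: "0 \<le> t" "t \<le> 1"
      "norm (embed (i + a - i) - t *\<^sub>R embed (i + a + b - i)) \<le> 2 * r"
    by (rule between_near_chord)
  then have "norm (embed a - t *\<^sub>R (embed a + embed b)) \<le> 2 * r"
    by simp
  then have "(norm (embed a - t *\<^sub>R (embed a + embed b)))\<^sup>2 \<le> (2 * r)\<^sup>2"
    by (rule power_mono) simp
  moreover have "(norm (embed a - t *\<^sub>R (embed a + embed b)))\<^sup>2 \<ge> 1/2"
    using assms t by (intro right_angle_far_from_segment norm_embed_ge_1)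
  ultimately show False
    using two_r_sq by linarith
qed

lemma word_admissible:
  assumes "word W"
  shows "admissible B (length W) (stops W)"
proof -
  have fr: "free (W ! n)" if "n < length W" for n
    using assms that by (simp add: word_def)
  have turn: "embed (W ! n) \<bullet> embed (W ! Suc n) \<le> 0" if "Suc n < length W" for n
    using assms that successively_nth unfolding word_def by fast
  show ?thesis
    unfolding admissible_def
  proof (intro conjI allI impI)
    show "stops W 0 = 0"
      by (simp add: stops_def)
    show "stops W (Suc n) \<noteq> stops W n" if "n < length W" for n
      using fr[OF that] that by (simp add: stops_Suc free_def)
    show "\<not> (\<exists>j. obstacle_between B j (stops W n) (stops W (Suc n)))" if "n < length W" for n
    proof
      assume "\<exists>j. obstacle_between B j (stops W n) (stops W (Suc n))"
      then obtain j where "obstacle_between B j (stops W n) (stops W (Suc n))"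
        by blast
      then have "obstacle_between B ((j - stops W n) + stops W n) (0 + stops W n)
          (W ! n + stops W n)"
        using that by (simp add: stops_Suc add.commute)
      then show False
        using fr[OF that] unfolding obstacle_between_shift free_def by blast
    qed
    show "\<not> obstacle_between B (stops W (Suc n)) (stops W n) (stops W (Suc (Suc n)))"
      if "Suc n < length W" for n
      using turn_unobstructed[of "W ! n" "W ! Suc n" "stops W n"] fr[of n] fr[of "Suc n"]
        turn[of n] that
      by (simp add: stops_Suc free_def)
  qed
qed

lemma embed_axis: "embed (axis i s) = axis i (of_int s)"
  by (simp add: vec_eq_iff axis_def)

text \<open>Every other lattice point is at distance at least \<open>1 > 2 * r\<close> from a unit edge of the lattice.\<close>
lemma free_axis:
  assumes "\<bar>s\<bar> = 1"
  shows "free (axis i s)"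
proof -
  have "\<not> obstacle_between B j 0 (axis i s)" for j
  proof
    assume b: "obstacle_between B j 0 (axis i s)"
    then obtain t where "0 \<le> t" "t \<le> 1" "norm (embed j - t *\<^sub>R embed (axis i s)) \<le> 2 * r"
      using between_near_chord by (metis diff_zero)
    moreover have "j \<noteq> 0" "j \<noteq> axis i s"
      using b unfolding obstacle_between_def by auto
    ultimately show False
      using norm_embed_diff_unit_segment_ge_1[OF refl assms, of j i t] two_r_less_1 by linarith
  qed
  moreover have "axis i s \<noteq> 0"
    using assms by (auto simp: axis_eq_0_iff)
  ultimately show ?thesis
    by (simp add: free_def)
qed

lemma inner_embed_axis: "embed a \<bullet> embed (axis i s) = of_int (a $ i * s)"
  by (simp add: embed_axis inner_axis)

lemma norm_embed_axis: "\<bar>s\<bar> = 1 \<Longrightarrow> norm (embed (axis i s)) = 1"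
  unfolding norm_eq_1 inner_embed_axis by (auto simp: axis_def abs_if split: if_splits)

lemma back_axis:
  obtains s where "\<bar>s\<bar> = 1" "embed a \<bullet> embed (axis i s) \<le> 0"
  by (cases "a $ i \<le> 0") (auto simp: inner_embed_axis intro: that[of 1] that[of "-1"])

lemma two_axes:
  obtains i j :: 'n where "i \<noteq> j"
proof -
  have "\<not> (\<forall>i j :: 'n. i = j)"
  proof
    assume "\<forall>i j :: 'n. i = j"
    then have "(UNIV :: 'n set) = {undefined}"
      by auto
    then show False
      using dim by (metis card.empty card_insert_disjoint empty_iff finite.emptyI not_less_eq_eq
          numeral_2_eq_2 order_refl)
  qed
  then show ?thesis
    using that by blast
qed

definition weight :: "(int ^ 'n) list \<Rightarrow> real" where
  "weight W = (\<Sum>x\<leftarrow>W. norm (embed x))"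

lemma weight_simps [simp]:
  "weight [] = 0" "weight (x # W) = norm (embed x) + weight W" "weight (V @ W) = weight V + weight W"
  by (simp_all add: weight_def)

lemma word_Nil [simp]: "word []"
  by (simp add: word_def)

lemma word_append:
  "word V \<Longrightarrow> word W \<Longrightarrow> (V \<noteq> [] \<Longrightarrow> W \<noteq> [] \<Longrightarrow> embed (last V) \<bullet> embed (hd W) \<le> 0)
    \<Longrightarrow> word (V @ W)"
  by (auto simp: word_def successively_append_iff)

text \<open>Two unit steps along different axes lead from any step to any other step.\<close>

lemma word_connect:
  assumes "word V" "word W"
  obtains C where "word (V @ C @ W)" "norm (embed (sum_list C)) \<le> 2" "weight C \<le> 2"
proof -
  obtain i j :: 'n where ij: "i \<noteq> j"
    by (rule two_axes)
  obtain s where s: "\<bar>s\<bar> = 1" "embed (last V) \<bullet> embed (axis i s) \<le> 0"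
    by (rule back_axis)
  obtain s' where s': "\<bar>s'\<bar> = 1" "embed (hd W) \<bullet> embed (axis j s') \<le> 0"
    by (rule back_axis)
  define C where "C = [axis i s, axis j s']"
  have "embed (axis i s) \<bullet> embed (axis j s') = 0"
    using ij unfolding inner_embed_axis by (simp add: axis_def)
  then have "word C"
    by (simp add: C_def word_def free_axis s s')
  then have "word (V @ C @ W)"
    using assms s s' by (intro word_append) (auto simp: C_def inner_commute)
  moreover have "norm (embed (sum_list C)) \<le> 2"
    using norm_triangle_ineq[of "embed (axis i s)" "embed (axis j s')"]
    by (simp add: C_def norm_embed_axis s s')
  moreover have "weight C \<le> 2"
    by (simp add: C_def norm_embed_axis s s')
  ultimately show ?thesis
    by (rule that)
qed

definition alternating :: "nat \<Rightarrow> int ^ 'n \<Rightarrow> int ^ 'n \<Rightarrow> (int ^ 'n) list" where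
  "alternating p a b = concat (replicate p [a, b])"

lemma alternating_simps:
  "alternating 0 a b = []" "alternating (Suc p) a b = a # b # alternating p a b"
  by (simp_all add: alternating_def)

lemma alternating_snoc: "alternating (Suc p) a b = alternating p a b @ [a, b]"
  by (induction p) (simp_all add: alternating_simps)

lemma hd_alternating: "alternating p a b \<noteq> [] \<Longrightarrow> hd (alternating p a b) = a"
  by (cases p) (simp_all add: alternating_simps)

lemma length_alternating: "length (alternating p a b) = 2 * p"
  by (induction p) (simp_all add: alternating_simps)

lemma sum_alternating: "embed (sum_list (alternating p a b)) = real p *\<^sub>R (embed a + embed b)"
  by (induction p) (simp_all add: alternating_simps algebra_simps)

lemma weight_alternating:
  "weight (alternating p a b) = real p * (norm (embed a) + norm (embed b))"
  by (induction p) (simp_all add: alternating_simps algebra_simps)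

lemma word_alternating:
  assumes "free a" "free b" "embed a \<bullet> embed b \<le> 0"
  shows "word (alternating p a b)"
proof (induction p)
  case (Suc p)
  have "word ([a, b] @ alternating p a b)"
    using assms Suc hd_alternating[of p a b]
    by (intro word_append) (auto simp: word_def inner_commute alternating_simps(1))
  then show ?case
    by (simp add: alternating_simps)
qed (simp add: alternating_simps)

section \<open>Travel times of words\<close>

definition minimal_path :: "(int ^ 'n) list \<Rightarrow> nat \<Rightarrow> real ^ 'n" where
  "minimal_path W = (SOME p. shortest (length W) (stops W) p)"

definition travel :: "(int ^ 'n) list \<Rightarrow> real" where
  "travel W = piece_length (length W) (minimal_path W)"

lemma minimal_path_shortest: "shortest (length W) (stops W) (minimal_path W)"
  unfolding minimal_path_def using shortest_exists by (rule someI_ex)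

lemma travel_Nil [simp]: "travel [] = 0"
  by (simp add: travel_def)

text \<open>Extend a shortest path by the translate by \<open>u\<close> of its last point.\<close>
lemma travel_snoc: "travel (W @ [u]) \<le> travel W + norm (embed u)"
proof -
  define q where "q i = (if i \<le> length W then minimal_path W i else minimal_path W (length W) + embed u)" for i
  have v: "minimal_path W i \<in> obs (stops W i)" for i
    using minimal_path_shortest unfolding shortest_def visits_def by blast
  have "visits (stops (W @ [u])) q"
    unfolding visits_def
  proof
    fix i
    show "q i \<in> obs (stops (W @ [u]) i)"
    proof (cases "i \<le> length W")
      case True
      then show ?thesis
        using v[of i] by (simp add: q_def stops_def)
    next
      case False
      then have "stops (W @ [u]) i = stops W (length W) + u"
        by (simp add: stops_def)
      then show ?thesis
        using False v[of "length W"] by (simp add: q_def mem_obs)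
    qed
  qed
  then have "travel (W @ [u]) \<le> piece_length (Suc (length W)) q"
    using minimal_path_shortest[of "W @ [u]"] unfolding shortest_def travel_def by simp
  also have "\<dots> = piece_length (length W) q + norm (embed u)"
    by (simp add: q_def dist_norm)
  also have "piece_length (length W) q = travel W"
    unfolding travel_def piece_length_def by (intro sum.cong) (auto simp: q_def)
  finally show ?thesis .
qed

lemma travel_append: "travel (V @ W) \<le> travel V + weight W"
proof (induction W rule: rev_induct)
  case (snoc u W)
  then show ?case
    using travel_snoc[of "V @ W" u] by simp
qed simp

lemma travel_le_weight: "travel W \<le> weight W"
  using travel_append[of "[]" W] by simp

lemma travel_ge_length:
  assumes "word W"
  shows "real (length W) * (1 - 2 * r) \<le> travel W"
proof -
  have v: "minimal_path W i \<in> obs (stops W i)" for i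
    using minimal_path_shortest unfolding shortest_def visits_def by blast
  have "(\<Sum>i<length W. 1 - 2 * r) \<le> travel W"
    unfolding travel_def piece_length_def
  proof (rule sum_mono)
    fix i
    assume "i \<in> {..<length W}"
    then have "stops W i \<noteq> stops W (Suc i)"
      using word_admissible[OF assms] unfolding admissible_def by (metis lessThan_iff)
    then show "1 - 2 * r \<le> dist (minimal_path W i) (minimal_path W (Suc i))"
      using v by (intro dist_obs_ge) auto
  qed
  then show ?thesis
    by simp
qed

text \<open>Weights bound travel times only from above. In order to prescribe the travel time up to a bounded
  error, a unit step and its opposite are appended repeatedly: each pair costs at most 2, and the
  total time tends to infinity because consecutive obstacles are at distance at least \<open>1 - 2 * r\<close>.\<close>
lemma word_pad:
  assumes W: "word W" and le: "weight W \<le> M"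
  obtains W' where "word W'" "sum_list W' = sum_list W" "M \<le> travel W'" "travel W' \<le> M + 2"
proof -
  obtain i :: 'n where True
    by blast
  obtain s where s: "\<bar>s\<bar> = 1" "embed (last W) \<bullet> embed (axis i s) \<le> 0"
    by (rule back_axis)
  define e where "e = axis i s"
  have e: "free e" "free (- e)" "norm (embed e) = 1"
    using free_axis[OF s(1)] free_axis[of "- s" i] s(1) norm_embed_axis[OF s(1)]
    by (simp_all add: e_def axis_def vec_eq_iff uminus_vec_def if_distrib cong: if_cong)
  define V where "V p = W @ alternating p e (- e)" for p
  have word_V: "word (V p)" for p
    unfolding V_def
    using W s(2) e hd_alternating[of p e "- e"]
    by (intro word_append word_alternating) (auto simp: e_def alternating_simps(1))
  have sum_V: "sum_list (V p) = sum_list W" for p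
    by (induction p) (simp_all add: V_def alternating_simps)
  have step: "travel (V (Suc p)) \<le> travel (V p) + 2" for p
    using travel_append[of "V p" "[e, - e]"] e by (simp add: V_def alternating_snoc)
  obtain p where p: "M < real p * (1 - 2 * r)"
    using reals_Archimedean3[of "1 - 2 * r"] two_r_less_1 by auto
  have "real p * (1 - 2 * r) \<le> real (length (V p)) * (1 - 2 * r)"
    using two_r_less_1 by (intro mult_right_mono) (auto simp: V_def length_alternating)
  also have "\<dots> \<le> travel (V p)"
    using word_V by (rule travel_ge_length)
  finally have ex: "M \<le> travel (V p)"
    using p by simp
  define m where "m = (LEAST p. M \<le> travel (V p))"
  have m: "M \<le> travel (V m)"
    unfolding m_def using ex by (rule LeastI)
  have "travel (V m) \<le> M + 2"
  proof (cases m)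
    case 0
    then show ?thesis
      using travel_le_weight[of W] le by (simp add: V_def alternating_simps)
  next
    case (Suc l)
    then have "\<not> M \<le> travel (V l)"
      using not_less_Least[of l "\<lambda>p. M \<le> travel (V p)"] by (simp add: m_def)
    then show ?thesis
      using step[of l] Suc by simp
  qed
  then show ?thesis
    using that[of "V m"] word_V sum_V m by blast
qed

lemma word_piece:
  assumes "word W" "W \<noteq> []"
  obtains x y where "admissible_piece B x y (travel W)"
    "norm ((y - x) - embed (sum_list W)) \<le> 1"
proof -
  let ?p = "minimal_path W" and ?s = "length W"
  have "trajectory_piece B ?s (stops W) ?p"
    using word_admissible[OF assms(1)] assms(2) minimal_path_shortest
    by (intro shortest_is_trajectory_piece) auto
  then have "admissible_piece B (?p 0) (?p ?s) (travel W)"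
    unfolding admissible_piece_def travel_def using word_admissible[OF assms(1)] by blast
  moreover have "norm ((?p ?s - ?p 0) - embed (sum_list W)) \<le> 1"
  proof -
    have v: "?p i \<in> obs (stops W i)" for i
      using minimal_path_shortest unfolding shortest_def visits_def by blast
    have "(?p ?s - ?p 0) - embed (sum_list W)
        = (?p ?s - (c + embed (stops W ?s))) - (?p 0 - (c + embed (stops W 0)))"
      by (simp add: stops_def)
    also have "norm \<dots> \<le> r + r"
      by (rule order_trans[OF norm_triangle_ineq4 add_mono[OF obs_near obs_near]]) (rule v)+
    finally show ?thesis
      using two_r_less_1 by simp
  qed
  ultimately show ?thesis
    by (rule that)
qed

end

section \<open>Attainable velocities\<close>

context small_obstacle
begin

text \<open>The error \<open>C\<close> is uniform in the time \<open>T\<close>. Weights are used in place of travel times because they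
  are additive under concatenation; only an upper bound is imposed, since words can be padded.\<close>
definition attainable :: "(real ^ 'n) set" where
  "attainable = {z. \<exists>C. \<forall>T\<ge>0. \<exists>W. word W \<and>
     norm (embed (sum_list W) - T *\<^sub>R z) \<le> C \<and> weight W \<le> T + C}"

lemma zero_attainable: "0 \<in> attainable"
  unfolding attainable_def by (auto intro!: exI[of _ 0] exI[of _ "[]"])

text \<open>To move with velocity \<open>u x + v y\<close> for the time \<open>T\<close>, move with velocity \<open>x\<close> for the time \<open>u T\<close>
  and then with velocity \<open>y\<close> for the time \<open>v T\<close>. Connecting the two words costs a bounded error.\<close>
lemma convex_attainable: "convex attainable"
proof (rule convexI)
  fix x y and u v :: real
  assume "x \<in> attainable" "y \<in> attainable" and uv: "0 \<le> u" "0 \<le> v" "u + v = 1"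
  then obtain Cx Cy where
    x: "\<And>T. T \<ge> 0 \<Longrightarrow> \<exists>W. word W \<and> norm (embed (sum_list W) - T *\<^sub>R x) \<le> Cx \<and> weight W \<le> T + Cx" and
    y: "\<And>T. T \<ge> 0 \<Longrightarrow> \<exists>W. word W \<and> norm (embed (sum_list W) - T *\<^sub>R y) \<le> Cy \<and> weight W \<le> T + Cy"
    unfolding attainable_def by blast
  have "\<exists>W. word W \<and> norm (embed (sum_list W) - T *\<^sub>R (u *\<^sub>R x + v *\<^sub>R y)) \<le> Cx + Cy + 2
      \<and> weight W \<le> T + (Cx + Cy + 2)" if T: "T \<ge> 0" for T
  proof -
    obtain X where X: "word X" "norm (embed (sum_list X) - (u * T) *\<^sub>R x) \<le> Cx"
        "weight X \<le> u * T + Cx"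
      using x[OF mult_nonneg_nonneg[OF uv(1) T]] by blast
    obtain Y where Y: "word Y" "norm (embed (sum_list Y) - (v * T) *\<^sub>R y) \<le> Cy"
        "weight Y \<le> v * T + Cy"
      using y[OF mult_nonneg_nonneg[OF uv(2) T]] by blast
    obtain C where C: "word (X @ C @ Y)" "norm (embed (sum_list C)) \<le> 2" "weight C \<le> 2"
      using word_connect[OF X(1) Y(1)] .
    have "embed (sum_list (X @ C @ Y)) - T *\<^sub>R (u *\<^sub>R x + v *\<^sub>R y)
        = (embed (sum_list X) - (u * T) *\<^sub>R x) + (embed (sum_list Y) - (v * T) *\<^sub>R y)
          + embed (sum_list C)"
      by (simp add: algebra_simps)
    also have "norm \<dots> \<le> norm (embed (sum_list X) - (u * T) *\<^sub>R x)
        + norm (embed (sum_list Y) - (v * T) *\<^sub>R y) + norm (embed (sum_list C))"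
      by (intro order_trans[OF norm_triangle_ineq] add_right_mono norm_triangle_ineq)
    also have "\<dots> \<le> Cx + Cy + 2"
      using X Y C by simp
    finally have "norm (embed (sum_list (X @ C @ Y)) - T *\<^sub>R (u *\<^sub>R x + v *\<^sub>R y)) \<le> Cx + Cy + 2" .
    moreover have "u * T + v * T = T"
      using uv by (simp add: distrib_right[symmetric])
    then have "weight (X @ C @ Y) \<le> T + (Cx + Cy + 2)"
      using X Y C by simp
    ultimately show ?thesis
      using C(1) by blast
  qed
  then show "u *\<^sub>R x + v *\<^sub>R y \<in> attainable"
    unfolding attainable_def by blast
qed

lemma scaled_attainable:
  assumes "z \<in> attainable" "0 \<le> t" "t \<le> 1"
  shows "t *\<^sub>R z \<in> attainable"
  using convexD[OF convex_attainable assms(1) zero_attainable, of t "1 - t"] assms by simp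

lemma attainable_turn:
  assumes "free a" "free b" "embed a \<bullet> embed b \<le> 0"
  shows "(embed a + embed b) /\<^sub>R (norm (embed a) + norm (embed b)) \<in> attainable"
proof -
  define w where "w = norm (embed a) + norm (embed b)"
  have w: "w > 0"
    using assms(1) by (simp add: w_def free_def add_pos_nonneg)
  have "\<exists>W. word W \<and> norm (embed (sum_list W) - T *\<^sub>R ((embed a + embed b) /\<^sub>R w)) \<le> w
      \<and> weight W \<le> T + w" if "T \<ge> 0" for T
  proof -
    define p where "p = nat \<lfloor>T / w\<rfloor>"
    have "real p = of_int \<lfloor>T / w\<rfloor>"
      using that w by (simp add: p_def)
    then have p: "real p \<le> T / w" "T / w - real p \<le> 1"
      by linarith+
    have "embed (sum_list (alternating p a b)) - T *\<^sub>R ((embed a + embed b) /\<^sub>R w)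
        = (real p - T / w) *\<^sub>R (embed a + embed b)"
      by (simp add: sum_alternating divide_inverse algebra_simps)
    also have "norm \<dots> = (T / w - real p) * norm (embed a + embed b)"
      using p by simp
    also have "\<dots> \<le> 1 * w"
      unfolding w_def using p by (intro mult_mono norm_triangle_ineq) (auto simp: w_def)
    finally have "norm (embed (sum_list (alternating p a b)) - T *\<^sub>R ((embed a + embed b) /\<^sub>R w)) \<le> w"
      by simp
    moreover have "weight (alternating p a b) \<le> T + w"
      using p(1) w by (simp add: weight_alternating w_def[symmetric] field_simps)
    ultimately show ?thesis
      using word_alternating[OF assms] by blast
  qed
  then show ?thesis
    unfolding attainable_def w_def by blast
qed

lemma attainable_turn_axis:
  assumes "free a" "\<bar>s\<bar> = 1" "embed a \<bullet> embed (axis i s) \<le> 0"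
  shows "(embed a + embed (axis i s)) /\<^sub>R (norm (embed a) + 1) \<in> attainable"
  using attainable_turn[OF assms(1) free_axis[OF assms(2)] assms(3)] norm_embed_axis[OF assms(2), of i]
  by simp

text \<open>If some coordinate of \<open>a\<close> vanishes, both unit vectors along that axis may follow \<open>a\<close>. They cancel
  on average, which leaves the speed \<open>N / (N + 1) \<ge> 1/2\<close>, where \<open>N = |a|\<close>. Otherwise one takes the unit
  vector \<open>- sgn (a $ i)\<close> along the \<open>i\<close>-th axis with frequency \<open>|a $ i| / s\<close>, where \<open>s\<close> is the sum of
  all \<open>|a $ i|\<close>. The average of the unit steps is then \<open>- a / s\<close>, and the speed is
  \<open>(1 - 1 / s) N / (N + 1)\<close>. Here \<open>s \<ge> 2\<close> and \<open>N \<ge> sqrt 2\<close>, with equality for instance for \<open>a = (1, 1)\<close>, and these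
  bounds give exactly \<open>1 - sqrt 2 / 2\<close>.\<close>
lemma attainable_free_direction:
  assumes a: "free a"
  shows "(1 - sqrt 2 / 2) *\<^sub>R sgn (embed a) \<in> attainable"
proof -
  define N where "N = norm (embed a)"
  have N: "N \<ge> 1"
    using a norm_embed_ge_1 by (auto simp: N_def free_def)
  have R: "0 \<le> 1 - sqrt 2 / 2"
    using sqrt2_less_2 by simp
  have reduce: ?thesis if "\<kappa> *\<^sub>R embed a \<in> attainable" "1 - sqrt 2 / 2 \<le> \<kappa> * N" for \<kappa>
  proof -
    have pos: "\<kappa> > 0"
    proof (rule ccontr)
      assume "\<not> \<kappa> > 0"
      then have "\<kappa> * N \<le> 0"
        using N by (simp add: mult_nonpos_nonneg)
      then show False
        using that(2) sqrt2_less_2 by linarith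
    qed
    then have "((1 - sqrt 2 / 2) / (\<kappa> * N)) *\<^sub>R (\<kappa> *\<^sub>R embed a) \<in> attainable"
      using that(2) R N pos by (intro scaled_attainable[OF that(1)]) (simp_all add: divide_le_eq)
    moreover have "((1 - sqrt 2 / 2) / (\<kappa> * N)) *\<^sub>R (\<kappa> *\<^sub>R embed a)
        = (1 - sqrt 2 / 2) *\<^sub>R sgn (embed a)"
    proof -
      have "x / (\<kappa> * N) * \<kappa> = x * inverse N" for x
        using pos by (simp add: field_simps)
      then show ?thesis
        by (simp only: scaleR_scaleR sgn_div_norm N_def)
    qed
    ultimately show ?thesis
      by simp
  qed
  show ?thesis
  proof (cases "\<exists>i. a $ i = 0")
    case True
    then obtain i where i: "a $ i = 0"
      by blast
    have "(embed a + embed (axis i 1)) /\<^sub>R (N + 1) \<in> attainable"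
      "(embed a + embed (axis i (- 1))) /\<^sub>R (N + 1) \<in> attainable"
      unfolding N_def by (intro attainable_turn_axis a; simp add: inner_embed_axis i)+
    then have "(1/2) *\<^sub>R ((embed a + embed (axis i 1)) /\<^sub>R (N + 1))
        + (1/2) *\<^sub>R ((embed a + embed (axis i (- 1))) /\<^sub>R (N + 1)) \<in> attainable"
      by (intro convexD[OF convex_attainable]) auto
    moreover have "(1/2) *\<^sub>R ((embed a + embed (axis i 1)) /\<^sub>R (N + 1))
        + (1/2) *\<^sub>R ((embed a + embed (axis i (- 1))) /\<^sub>R (N + 1)) = (1 / (N + 1)) *\<^sub>R embed a"
    proof -
      have "embed (axis i (- 1)) = - embed (axis i 1)"
        by (simp add: vec_eq_iff axis_def)
      then have "(embed a + embed (axis i 1)) + (embed a + embed (axis i (- 1))) = 2 *\<^sub>R embed a"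
        by (simp add: scaleR_2)
      then show ?thesis
        unfolding scaleR_add_right[symmetric] by (simp add: inverse_eq_divide)
    qed
    ultimately have "(1 / (N + 1)) *\<^sub>R embed a \<in> attainable"
      by simp
    moreover have "1 - sqrt 2 / 2 \<le> 1 / (N + 1) * N"
    proof -
      have "sqrt 2 \<ge> 1"
        by simp
      then have "1 - sqrt 2 / 2 \<le> 1 / 2"
        by simp
      also have "\<dots> \<le> 1 / (N + 1) * N"
        using N by (simp add: field_simps)
      finally show ?thesis .
    qed
    ultimately show ?thesis
      by (rule reduce)
  next
    case False
    define s where "s = (\<Sum>i\<in>UNIV. \<bar>real_of_int (a $ i)\<bar>)"
    define \<sigma> where "\<sigma> i = (if a $ i > 0 then - 1 else 1 :: int)" for i
    have comp: "\<bar>real_of_int (a $ i)\<bar> \<ge> 1" for i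
      using False[simplified, rule_format, of i] by linarith
    have "real CARD('n) = (\<Sum>i\<in>(UNIV :: 'n set). 1)"
      by simp
    also have "\<dots> \<le> s"
      unfolding s_def using comp by (intro sum_mono)
    finally have s: "s \<ge> 2"
      using dim by linarith
    have "real CARD('n) = (\<Sum>i\<in>(UNIV :: 'n set). 1)"
      by simp
    also have "\<dots> \<le> N\<^sup>2"
      unfolding N_def power2_norm_eq_inner inner_vec_def
      using one_le_power[OF comp, where n = 2] by (intro sum_mono) (simp add: power2_eq_square)
    finally have "2 \<le> N\<^sup>2"
      using dim by linarith
    then have N2: "sqrt 2 \<le> N"
      using N by (intro real_le_lsqrt) auto
    have "(\<Sum>i\<in>UNIV. (\<bar>real_of_int (a $ i)\<bar> / s) *\<^sub>R ((embed a + embed (axis i (\<sigma> i))) /\<^sub>R (N + 1)))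
        \<in> attainable"
    proof (rule convex_sum)
      show "(\<Sum>i\<in>UNIV. \<bar>real_of_int (a $ i)\<bar> / s) = 1"
        using s by (simp add: sum_divide_distrib[symmetric] s_def[symmetric])
      show "(embed a + embed (axis i (\<sigma> i))) /\<^sub>R (N + 1) \<in> attainable" for i
        unfolding N_def using a
        by (intro attainable_turn_axis) (auto simp: \<sigma>_def inner_embed_axis)
    qed (use s convex_attainable in auto)
    also have "(\<Sum>i\<in>UNIV. (\<bar>real_of_int (a $ i)\<bar> / s) *\<^sub>R ((embed a + embed (axis i (\<sigma> i))) /\<^sub>R (N + 1)))
        = ((1 - 1 / s) / (N + 1)) *\<^sub>R embed a"
    proof -
      have signs: "(\<Sum>i\<in>UNIV. \<bar>real_of_int (a $ i)\<bar> *\<^sub>R embed (axis i (\<sigma> i))) = - embed a"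
      proof -
        have "(\<Sum>i\<in>UNIV. \<bar>real_of_int (a $ i)\<bar> *\<^sub>R embed (axis i (\<sigma> i))) $ j = (- embed a) $ j" for j
        proof -
          have "(\<Sum>i\<in>UNIV. \<bar>real_of_int (a $ i)\<bar> *\<^sub>R embed (axis i (\<sigma> i))) $ j
              = (\<Sum>i\<in>UNIV. if i = j then \<bar>real_of_int (a $ i)\<bar> * of_int (\<sigma> i) else 0)"
            unfolding sum_component by (intro sum.cong) (auto simp: axis_def)
          also have "\<dots> = (- embed a) $ j"
            by (simp add: \<sigma>_def)
          finally show ?thesis .
        qed
        then show ?thesis
          by (simp add: vec_eq_iff)
      qed
      have "(\<Sum>i\<in>UNIV. (\<bar>real_of_int (a $ i)\<bar> / s) *\<^sub>R ((embed a + embed (axis i (\<sigma> i))) /\<^sub>R (N + 1)))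
          = (1 / (s * (N + 1))) *\<^sub>R (\<Sum>i\<in>UNIV. \<bar>real_of_int (a $ i)\<bar> *\<^sub>R embed a
              + \<bar>real_of_int (a $ i)\<bar> *\<^sub>R embed (axis i (\<sigma> i)))"
        unfolding scaleR_sum_right
        by (intro sum.cong) (simp_all add: divide_inverse scaleR_add_right mult.assoc mult.left_commute mult.commute)
      also have "\<dots> = (1 / (s * (N + 1))) *\<^sub>R (s *\<^sub>R embed a - embed a)"
        unfolding sum.distrib signs scaleR_sum_left[symmetric] s_def by simp
      also have "s *\<^sub>R embed a - embed a = (s - 1) *\<^sub>R embed a"
        by (simp add: scaleR_left_diff_distrib)
      also have "(1 / (s * (N + 1))) *\<^sub>R (s - 1) *\<^sub>R embed a
          = (1 / (s * (N + 1)) * (s - 1)) *\<^sub>R embed a"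
        by (rule scaleR_scaleR)
      also have "1 / (s * (N + 1)) * (s - 1) = (1 - 1 / s) / (N + 1)"
        using s N by (simp add: field_simps)
      finally show ?thesis .
    qed
    finally have "((1 - 1 / s) / (N + 1)) *\<^sub>R embed a \<in> attainable" .
    moreover have "1 - sqrt 2 / 2 \<le> (1 - 1 / s) / (N + 1) * N"
    proof -
      have q: "sqrt 2 * sqrt 2 = 2" "sqrt 2 \<ge> 1"
        by simp_all
      then have "(sqrt 2 - 1) * sqrt 2 \<le> (sqrt 2 - 1) * N"
        using N2 by (intro mult_left_mono) auto
      then have "(2 - sqrt 2) * (N + 1) \<le> N"
        using q by (simp add: algebra_simps)
      then have "2 - sqrt 2 \<le> N / (N + 1)"
        using N by (simp add: le_divide_eq)
      then have "(1/2) * (2 - sqrt 2) \<le> (1 - 1 / s) * (N / (N + 1))"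
        using s N sqrt2_less_2 by (intro mult_mono) (auto simp: field_simps)
      moreover have "(1/2) * (2 - sqrt 2) = 1 - sqrt 2 / 2"
        by simp
      moreover have "(1 - 1 / s) * (N / (N + 1)) = (1 - 1 / s) / (N + 1) * N"
        by simp
      ultimately show ?thesis
        by (simp only:)
    qed
    ultimately show ?thesis
      by (rule reduce)
  qed
qed

text \<open>Approximate \<open>z\<close> by an attainable \<open>z'\<close> and run it for a time \<open>T\<close> that is long compared with its
  error constant \<open>C\<close>; padding makes the travel time equal to \<open>T\<close> up to \<open>C + 2\<close>. The factor \<open>C + 3\<close> in
  the choice of \<open>T\<close> absorbs this error together with the error \<open>C + 1\<close> of the displacement, in which
  1 accounts for the positions of the two end points on their obstacles.\<close>
lemma closure_attainable_subset: "closure attainable \<subseteq> admissible_rotation_set B"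
proof
  fix z
  assume z: "z \<in> closure attainable"
  have "\<exists>x y t. admissible_piece B x y t \<and> real n \<le> t \<and>
      norm ((y - x) /\<^sub>R t - z) \<le> (2 + norm z) * (1 / (real n + 1))" for n
  proof -
    obtain z' where z': "z' \<in> attainable" "norm (z' - z) < 1 / (real n + 1)"
      using z closure_approachable[of z attainable]
      by (metis dist_norm divide_pos_pos of_nat_0_le_iff add_nonneg_pos zero_less_one)
    then obtain C where C: "\<And>T. T \<ge> 0 \<Longrightarrow> \<exists>W. word W \<and> norm (embed (sum_list W) - T *\<^sub>R z') \<le> C
        \<and> weight W \<le> T + C"
      unfolding attainable_def by blast
    have "C \<ge> 0"
      using C[of 0] norm_ge_zero order_trans by blast
    define T where "T = (real n + 1) * (C + 3)"
    have T: "T > 0"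
      using \<open>C \<ge> 0\<close> by (simp add: T_def)
    obtain V where V: "word V" "norm (embed (sum_list V) - T *\<^sub>R z') \<le> C" "weight V \<le> T + C"
      using C[OF less_imp_le[OF T]] by blast
    obtain W where W: "word W" "sum_list W = sum_list V" "T + C \<le> travel W" "travel W \<le> T + C + 2"
      using word_pad[OF V(1,3)] .
    define t where "t = travel W"
    have t: "T \<le> t" "t \<le> T + C + 2" "t > 0"
      using W T \<open>C \<ge> 0\<close> by (auto simp: t_def)
    have "W \<noteq> []"
      using t(3) by (auto simp: t_def)
    then obtain x y where xy: "admissible_piece B x y t"
        "norm ((y - x) - embed (sum_list W)) \<le> 1"
      using word_piece[OF W(1)] unfolding t_def by blast
    have "(y - x) - t *\<^sub>R z = ((y - x) - embed (sum_list W)) + (embed (sum_list V) - T *\<^sub>R z')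
        + T *\<^sub>R (z' - z) + (T - t) *\<^sub>R z"
      by (simp add: W(2) algebra_simps)
    also have "norm \<dots> \<le> norm ((y - x) - embed (sum_list W)) + norm (embed (sum_list V) - T *\<^sub>R z')
        + norm (T *\<^sub>R (z' - z)) + norm ((T - t) *\<^sub>R z)"
      by (intro order_trans[OF norm_triangle_ineq] add_right_mono norm_triangle_ineq)
    also have "\<dots> \<le> 1 + C + t * (1 / (real n + 1)) + (C + 2) * norm z"
      unfolding norm_scaleR using xy(2) V(2) t T z'(2) \<open>C \<ge> 0\<close>
      by (intro add_mono mult_mono mult_right_mono) auto
    also have "\<dots> \<le> (C + 3) * (1 + norm z) + t * (1 / (real n + 1))"
      using \<open>C \<ge> 0\<close> by (simp add: algebra_simps)
    also have "C + 3 = T * (1 / (real n + 1))"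
      by (simp add: T_def)
    also have "T * (1 / (real n + 1)) * (1 + norm z) \<le> t * (1 / (real n + 1)) * (1 + norm z)"
      using t by (intro mult_right_mono) auto
    also have "t * (1 / (real n + 1)) * (1 + norm z) + t * (1 / (real n + 1))
        = t * ((2 + norm z) * (1 / (real n + 1)))"
    proof -
      have "t * k * (1 + norm z) + t * k = t * ((2 + norm z) * k)" for k
        by (simp add: algebra_simps)
      then show ?thesis .
    qed
    finally have *: "norm ((y - x) - t *\<^sub>R z) \<le> t * ((2 + norm z) * (1 / (real n + 1)))"
      by simp
    have "(y - x) /\<^sub>R t - z = ((y - x) - t *\<^sub>R z) /\<^sub>R t"
      using t by (simp add: algebra_simps)
    then have "norm ((y - x) /\<^sub>R t - z) = norm ((y - x) - t *\<^sub>R z) / t"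
      using t by (simp add: divide_inverse mult.commute)
    also have "\<dots> \<le> (2 + norm z) * (1 / (real n + 1))"
      using * t by (simp add: pos_divide_le_eq mult.commute)
    finally have "norm ((y - x) /\<^sub>R t - z) \<le> (2 + norm z) * (1 / (real n + 1))" .
    moreover have "(real n + 1) * 1 \<le> T"
      unfolding T_def using \<open>C \<ge> 0\<close> by (intro mult_left_mono) auto
    then have "real n \<le> t"
      using t by simp
    ultimately show ?thesis
      using xy(1) by blast
  qed
  then obtain x y t where xyt: "\<And>n. admissible_piece B (x n) (y n) (t n)" "\<And>n. real n \<le> t n"
    "\<And>n. norm ((y n - x n) /\<^sub>R t n - z) \<le> (2 + norm z) * (1 / (real n + 1))"
    by metis
  have "filterlim t at_top sequentially"
    by (rule filterlim_at_top_mono[OF filterlim_real_sequentially]) (simp add: xyt(2))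
  moreover have "(\<lambda>n. (y n - x n) /\<^sub>R t n - z) \<longlonglongrightarrow> 0"
  proof (rule Lim_null_comparison)
    show "\<forall>\<^sub>F n in sequentially. norm ((y n - x n) /\<^sub>R t n - z) \<le> (2 + norm z) * (1 / (real n + 1))"
      using xyt(3) by simp
    have "(\<lambda>n. (2 + norm z) * (1 / real (Suc n))) \<longlonglongrightarrow> (2 + norm z) * 0"
      by (intro tendsto_mult_left LIMSEQ_Suc lim_1_over_n)
    then show "(\<lambda>n. (2 + norm z) * (1 / (real n + 1))) \<longlonglongrightarrow> 0"
      by (simp add: add.commute)
  qed
  then have "(\<lambda>n. (y n - x n) /\<^sub>R t n) \<longlonglongrightarrow> z"
    by (rule LIM_zero_cancel)
  ultimately show "z \<in> admissible_rotation_set B"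
    unfolding admissible_rotation_set_def using xyt(1) by blast
qed

end

section \<open>Free steps in every direction\<close>

text \<open>The triangle inequality for angles between unit vectors. Put \<open>p = u \<bullet> v\<close>, \<open>q = v \<bullet> w\<close>. The parts of \<open>u\<close> and \<open>w\<close> orthogonal to \<open>v\<close>
  have norms \<open>sqrt (1 - p\<^sup>2)\<close> and \<open>sqrt (1 - q\<^sup>2)\<close>, so the Cauchy-Schwarz inequality turns
  into the addition theorem for the cosine.\<close>
lemma cos_add_le_inner:
  fixes u v w :: "'a::real_inner"
  assumes "norm u = 1" "norm v = 1" "norm w = 1"
    and "0 \<le> \<alpha>" "0 \<le> \<beta>" "\<alpha> + \<beta> \<le> pi"
    and "cos \<alpha> \<le> u \<bullet> v" "cos \<beta> \<le> v \<bullet> w"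
  shows "cos (\<alpha> + \<beta>) \<le> u \<bullet> w"
proof -
  define p q where "p = u \<bullet> v" and "q = v \<bullet> w"
  have pq: "\<bar>p\<bar> \<le> 1" "\<bar>q\<bar> \<le> 1"
    using Cauchy_Schwarz_ineq2[of u v] Cauchy_Schwarz_ineq2[of v w] assms(1-3)
    by (auto simp: p_def q_def)
  have uu: "u \<bullet> u = 1" "v \<bullet> v = 1" "w \<bullet> w = 1"
    using assms(1-3) by (simp_all add: dot_square_norm)
  have "arccos p \<le> arccos (cos \<alpha>)"
    using pq assms(7) by (intro arccos_le_arccos) (auto simp: p_def)
  then have a: "arccos p \<le> \<alpha>"
    using assms(4-6) by (simp add: arccos_cos)
  have "arccos q \<le> arccos (cos \<beta>)"
    using pq assms(8) by (intro arccos_le_arccos) (auto simp: q_def)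
  then have b: "arccos q \<le> \<beta>"
    using assms(4-6) by (simp add: arccos_cos)
  have "cos (\<alpha> + \<beta>) \<le> cos (arccos p + arccos q)"
    using a b pq assms(6) arccos_lbound[of p] arccos_lbound[of q]
    by (intro cos_monotone_0_pi_le) auto
  also have "\<dots> = p * q - sqrt (1 - p\<^sup>2) * sqrt (1 - q\<^sup>2)"
    using pq by (simp add: cos_add sin_arccos cos_arccos abs_le_iff)
  also have "\<dots> = p * q - norm (u - p *\<^sub>R v) * norm (w - q *\<^sub>R v)"
    unfolding norm_eq_sqrt_inner
    by (simp add: inner_diff_left inner_diff_right uu p_def q_def inner_commute power2_eq_square)
  also have "\<dots> \<le> p * q + (u - p *\<^sub>R v) \<bullet> (w - q *\<^sub>R v)"
    using Cauchy_Schwarz_ineq2[of "u - p *\<^sub>R v" "w - q *\<^sub>R v"] by linarith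
  also have "\<dots> = u \<bullet> w"
    by (simp add: inner_diff_left inner_diff_right uu p_def q_def inner_commute algebra_simps)
  finally show ?thesis .
qed

text \<open>The factor 2 is exact although \<open>a\<close> need not lie on the segment from 0 to \<open>x = a + b\<close>; this uses the
  integrality of inner products. Put \<open>A = |a|\<^sup>2\<close>, \<open>C = |b|\<^sup>2\<close>, \<open>c = a \<bullet> b\<close>. The squared distance of \<open>a\<close> from
  the line through 0 and \<open>x\<close> is \<open>(A C - c\<^sup>2) / |x|\<^sup>2\<close>, and it is smaller than 1/2. That inequality
  says \<open>(A - 1/2) (C - 1/2) < (c + 1/2)\<^sup>2\<close>, so \<open>A - 1/2 < c + 1/2\<close> and, for integers, \<open>A \<le> c\<close>.
  Then \<open>|x|\<^sup>2 = A + C + 2 c \<ge> 4 A\<close>. The same distance, divided by \<open>|a|\<close>, is the sine of the angle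
  between \<open>a\<close> and \<open>x\<close>.\<close>
lemma shorter_part:
  fixes a b :: "int ^ 'n"
  assumes nz: "a \<noteq> 0" "b \<noteq> 0" and le: "norm (embed a) \<le> norm (embed b)"
    and t: "0 \<le> t" "t \<le> 1"
    and near: "norm (embed a - t *\<^sub>R (embed a + embed b)) \<le> \<rho>" and \<rho>: "\<rho>\<^sup>2 < 1/2"
  shows "2 * norm (embed a) \<le> norm (embed a + embed b)"
    and "cos (arcsin (\<rho> / norm (embed a))) \<le> sgn (embed a) \<bullet> sgn (embed a + embed b)"
proof -
  define x where "x = embed a + embed b"
  define A where "A = embed a \<bullet> embed a"
  define C where "C = embed b \<bullet> embed b"
  define c where "c = embed a \<bullet> embed b"
  obtain A' c' :: int where int: "A = of_int A'" "c = of_int c'"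
    unfolding A_def c_def inner_embed by blast
  have AC: "1 \<le> A" "A \<le> C"
    using norm_embed_ge_1[OF nz(1)] le
    by (simp_all add: A_def C_def dot_square_norm one_le_power power_mono)
  have near2: "(norm (embed a - t *\<^sub>R x))\<^sup>2 \<le> \<rho>\<^sup>2"
    unfolding x_def by (rule power_mono[OF near]) simp
  have "c > 0"
    using right_angle_far_from_segment[of "embed a" "embed b" t] norm_embed_ge_1 nz t near2 \<rho>
    unfolding x_def c_def by force
  have X: "x \<bullet> x = A + C + 2 * c" and ax: "embed a \<bullet> x = A + c"
    by (simp_all add: x_def A_def C_def c_def inner_add_left inner_add_right inner_commute)
  have "(norm (embed a - t *\<^sub>R x))\<^sup>2 = A - 2 * t * (A + c) + t\<^sup>2 * (A + C + 2 * c)"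
  proof -
    have "(norm (embed a - t *\<^sub>R x))\<^sup>2 = A - 2 * t * (embed a \<bullet> x) + t\<^sup>2 * (x \<bullet> x)"
      unfolding power2_norm_eq_inner
      by (simp add: inner_diff_left inner_diff_right inner_commute A_def power2_eq_square)
    then show ?thesis
      by (simp only: X ax)
  qed
  then have "(norm (embed a - t *\<^sub>R x))\<^sup>2 * (A + C + 2 * c)
      = A * C - c\<^sup>2 + (t * (A + C + 2 * c) - (A + c))\<^sup>2"
    by (simp only:) (simp add: power2_eq_square algebra_simps)
  moreover have "(norm (embed a - t *\<^sub>R x))\<^sup>2 * (A + C + 2 * c) \<le> \<rho>\<^sup>2 * (A + C + 2 * c)"
    using near2 AC \<open>c > 0\<close> by (intro mult_right_mono) auto
  ultimately have D: "A * C - c\<^sup>2 \<le> \<rho>\<^sup>2 * (A + C + 2 * c)"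
    using zero_le_power2[of "t * (A + C + 2 * c) - (A + c)"] by linarith
  also have "\<dots> < 1/2 * (A + C + 2 * c)"
    using \<rho> AC \<open>c > 0\<close> by (intro mult_strict_right_mono) auto
  finally have "(A - 1/2) * (C - 1/2) < (c + 1/2)\<^sup>2"
    by (simp add: power2_eq_square algebra_simps)
  moreover have "(A - 1/2)\<^sup>2 \<le> (A - 1/2) * (C - 1/2)"
    unfolding power2_eq_square using AC by (intro mult_left_mono) auto
  ultimately have "(A - 1/2)\<^sup>2 < (c + 1/2)\<^sup>2"
    by linarith
  then have "A - 1/2 < c + 1/2"
    by (rule power_less_imp_less_base) (use \<open>c > 0\<close> in simp)
  then have "real_of_int A' < real_of_int (c' + 1)"
    by (simp add: int)
  then have "A' < c' + 1"
    by (simp only: of_int_less_iff)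
  then have "A \<le> c"
    by (simp add: int)
  then have "(2 * norm (embed a))\<^sup>2 \<le> (norm x)\<^sup>2"
    using AC X by (simp add: power_mult_distrib power2_norm_eq_inner A_def[symmetric])
  then show "2 * norm (embed a) \<le> norm (embed a + embed b)"
    unfolding x_def by (rule power2_le_imp_le) simp
  define N where "N = norm (embed a)"
  define M where "M = norm x"
  have N: "N \<ge> 1" "N\<^sup>2 = A"
    using norm_embed_ge_1 nz by (auto simp: N_def A_def power2_norm_eq_inner)
  have M2: "M\<^sup>2 = A + C + 2 * c"
    using X by (simp add: M_def power2_norm_eq_inner)
  have M: "M > 0"
    using M2 AC \<open>c > 0\<close> by (cases "M = 0") (auto simp: M_def)
  have "\<bar>\<rho>\<bar> \<le> 1"
    using \<rho> by (simp add: abs_square_le_1[symmetric])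
  then have r1: "\<bar>\<rho> / N\<bar> \<le> 1"
    using N by (simp add: divide_le_eq)
  have "sqrt (1 - (\<rho> / N)\<^sup>2) \<le> (A + c) / (N * M)"
  proof (rule real_le_lsqrt)
    show "0 \<le> (A + c) / (N * M)"
      using AC \<open>c > 0\<close> N M by simp
    have "A * (A + C + 2 * c) - \<rho>\<^sup>2 * (A + C + 2 * c) \<le> (A + c)\<^sup>2"
      using D by (simp add: power2_eq_square algebra_simps)
    then have "N\<^sup>2 * M\<^sup>2 - \<rho>\<^sup>2 * M\<^sup>2 \<le> (A + c)\<^sup>2"
      using N M2 by simp
    then have "(N\<^sup>2 * M\<^sup>2 - \<rho>\<^sup>2 * M\<^sup>2) / (N\<^sup>2 * M\<^sup>2) \<le> (A + c)\<^sup>2 / (N\<^sup>2 * M\<^sup>2)"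
      by (rule divide_right_mono) simp
    moreover have "N\<^sup>2 \<noteq> 0" "M\<^sup>2 \<noteq> 0"
      using N(1) M by auto
    ultimately show "1 - (\<rho> / N)\<^sup>2 \<le> ((A + c) / (N * M))\<^sup>2"
      by (simp add: power_divide power_mult_distrib diff_divide_distrib)
  qed
  moreover have "cos (arcsin (\<rho> / N)) = sqrt (1 - (\<rho> / N)\<^sup>2)"
    using abs_le_D1[OF r1] abs_le_D2[OF r1] by (intro cos_arcsin) linarith+
  moreover have "sgn (embed a) \<bullet> sgn x = (A + c) / (N * M)"
    by (simp add: sgn_div_norm N_def M_def ax divide_inverse)
  ultimately show "cos (arcsin (\<rho> / norm (embed a))) \<le> sgn (embed a) \<bullet> sgn (embed a + embed b)"
    by (simp add: N_def x_def)
qed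

text \<open>On \<open>[0, pi / 4]\<close> the derivative of the sine is at least \<open>sqrt 2 / 2\<close>.\<close>
lemma arcsin_le_sqrt2_mult:
  assumes "0 \<le> x" "x \<le> sqrt 2 / 2"
  shows "arcsin x \<le> sqrt 2 * x"
proof (cases "x = 0")
  case False
  have x1: "x \<le> 1"
    using assms sqrt2_less_2 by linarith
  define y where "y = arcsin x"
  have "arcsin x \<le> arcsin (sin (pi / 4))"
    using assms by (intro arcsin_le_arcsin) (auto simp: sin_45 sqrt2_less_2 less_imp_le)
  then have y4: "y \<le> pi / 4"
    unfolding y_def by (subst (asm) arcsin_sin) auto
  have y: "sin y = x" "y \<ge> 0"
    using assms x1 by (auto simp: y_def arcsin_nonneg)
  then have "y > 0"
    using False by (cases "y = 0") auto
  then obtain \<xi> where \<xi>: "0 < \<xi>" "\<xi> < y" "sin y - sin 0 = (y - 0) * cos \<xi>"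
    using MVT2[of 0 y sin cos] DERIV_sin by blast
  have "sqrt 2 / 2 \<le> cos \<xi>"
    using \<xi> y4 cos_monotone_0_pi_le[of \<xi> "pi / 4"] by (simp add: cos_45)
  then have "y * (sqrt 2 / 2) \<le> x"
    using \<xi>(3) y \<open>y > 0\<close> by (simp add: mult_left_mono)
  then have "sqrt 2 * (y * (sqrt 2 / 2)) \<le> sqrt 2 * x"
    by (intro mult_left_mono) auto
  moreover have "sqrt 2 * (y * (sqrt 2 / 2)) = y"
    by (simp add: field_simps)
  ultimately show ?thesis
    by (metis y_def)
qed simp

text \<open>Round a large multiple of \<open>u\<close> down in each coordinate.\<close>
lemma lattice_direction_near:
  fixes u :: "real ^ 'n"
  assumes "norm u = 1" "\<epsilon> > 0"
  obtains x where "x \<noteq> 0" "norm (sgn (embed x) - u) < \<epsilon>"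
proof -
  let ?m = "real CARD('n)"
  obtain n :: nat where n: "2 * ?m / \<epsilon> + ?m < real n"
    using reals_Archimedean2 by blast
  have m: "?m > 0"
    by simp
  have "2 * ?m / \<epsilon> \<ge> 0"
    using assms by simp
  then have n0: "real n > ?m" "real n > 0"
    using n m by linarith+
  define x :: "int ^ 'n" where "x = (\<chi> i. \<lfloor>real n * u $ i\<rfloor>)"
  have d: "norm (embed x - real n *\<^sub>R u) \<le> ?m"
  proof -
    have "norm (embed x - real n *\<^sub>R u) \<le> (\<Sum>i\<in>UNIV. \<bar>(embed x - real n *\<^sub>R u) $ i\<bar>)"
      by (rule norm_le_l1_cart)
    also have "\<dots> \<le> (\<Sum>i\<in>(UNIV :: 'n set). 1)"
    proof (rule sum_mono)
      fix i
      have "of_int \<lfloor>real n * u $ i\<rfloor> \<le> real n * u $ i" "real n * u $ i \<le> of_int \<lfloor>real n * u $ i\<rfloor> + 1"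
        by linarith+
      then show "\<bar>(embed x - real n *\<^sub>R u) $ i\<bar> \<le> 1"
        by (simp add: x_def) linarith
    qed
    finally show ?thesis
      by simp
  qed
  have nu: "norm (real n *\<^sub>R u) = real n"
    using assms by simp
  have nx: "\<bar>norm (embed x) - real n\<bar> \<le> ?m"
    using norm_triangle_ineq3[of "embed x" "real n *\<^sub>R u"] d nu by linarith
  then have "x \<noteq> 0"
    using n0 by auto
  have "real n *\<^sub>R (sgn (embed x) - u) = (embed x - real n *\<^sub>R u)
      + (real n - norm (embed x)) *\<^sub>R sgn (embed x)"
    using \<open>x \<noteq> 0\<close> by (simp add: sgn_div_norm algebra_simps)
  then have "real n * norm (sgn (embed x) - u) \<le> norm (embed x - real n *\<^sub>R u)
      + norm ((real n - norm (embed x)) *\<^sub>R sgn (embed x))"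
    by (metis abs_of_nat norm_scaleR norm_triangle_ineq)
  also have "\<dots> \<le> ?m + ?m"
    using d nx \<open>x \<noteq> 0\<close> by (intro add_mono) (auto simp: norm_sgn abs_minus_commute)
  also have "\<dots> < \<epsilon> * real n"
  proof -
    have "2 * ?m / \<epsilon> < real n"
      using n m by linarith
    then show ?thesis
      using assms by (simp add: divide_less_eq mult.commute)
  qed
  finally have "norm (sgn (embed x) - u) < \<epsilon>"
    using n0 by (simp add: mult.commute)
  then show ?thesis
    using that \<open>x \<noteq> 0\<close> by blast
qed

context small_obstacle
begin

lemma eta_term: "r / 2 powi (int n - 1) = 2 * r * (1/2) ^ n"
  by (simp add: power_int_diff power_one_over field_simps)

lemma eta_term_bounds:
  "0 \<le> arcsin (2 * r * (1/2) ^ n)" "arcsin (2 * r * (1/2) ^ n) \<le> sqrt 2 * (2 * r) * (1/2) ^ n"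
proof -
  have p: "0 \<le> (1/2 :: real) ^ n" "(1/2 :: real) ^ n \<le> 1"
    by (auto intro: power_le_one)
  have "2 * r * (1/2) ^ n \<le> 2 * r * 1"
    using p r_nonneg by (intro mult_left_mono) auto
  then have x: "0 \<le> 2 * r * (1/2) ^ n" "2 * r * (1/2) ^ n \<le> sqrt 2 / 2" "2 * r * (1/2) ^ n \<le> 1"
    using small r_nonneg p two_r_less_1 by auto
  then show "0 \<le> arcsin (2 * r * (1/2) ^ n)"
    by (intro arcsin_nonneg) auto
  show "arcsin (2 * r * (1/2) ^ n) \<le> sqrt 2 * (2 * r) * (1/2) ^ n"
    using arcsin_le_sqrt2_mult[OF x(1,2)] by (simp add: mult.assoc)
qed

lemma eta_summable: "summable (\<lambda>n. arcsin (2 * r * (1/2) ^ n))"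
proof (rule summable_comparison_test')
  show "summable (\<lambda>n. sqrt 2 * (2 * r) * (1/2 :: real) ^ n)"
    by (intro summable_mult summable_geometric) simp
  show "norm (arcsin (2 * r * (1/2) ^ n)) \<le> sqrt 2 * (2 * r) * (1/2) ^ n" for n
    using eta_term_bounds[of n] by simp
qed

lemma eta_eq: "eta r = (\<Sum>n. arcsin (2 * r * (1/2) ^ n))"
  by (simp add: eta_def eta_term)

lemma partial_eta_le: "(\<Sum>n<N. arcsin (2 * r * (1/2) ^ n)) \<le> eta r"
  unfolding eta_eq using eta_term_bounds eta_summable by (intro sum_le_suminf) auto

text \<open>This keeps all the accumulated angles in the range in which the cosine is decreasing.\<close>
lemma eta_le_pi: "eta r \<le> pi"
proof -
  have "eta r \<le> (\<Sum>n. sqrt 2 * (2 * r) * (1/2 :: real) ^ n)"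
    unfolding eta_eq using eta_term_bounds eta_summable
    by (intro suminf_le summable_mult summable_geometric) auto
  also have "\<dots> = sqrt 2 * (4 * r)"
    by (subst suminf_mult) (simp_all add: suminf_geometric)
  also have "\<dots> \<le> sqrt 2 * sqrt 2"
    using small by (intro mult_left_mono) auto
  also have "\<dots> \<le> pi"
    using pi_gt3 by simp
  finally show ?thesis .
qed

text \<open>Induction on the integer part of \<open>|x|\<close>, halving the norm at each step. The bound \<open>2 ^ N \<le> |x|\<close>, where
  \<open>N\<close> counts the steps down to \<open>a\<close>, is what makes the angle added by the next step at most the \<open>N\<close>-th
  term of the series for \<open>eta r\<close>.\<close>
lemma free_direction_near_lattice_direction:
  assumes "x \<noteq> 0"
  obtains a where "free a" "cos (eta r) \<le> sgn (embed a) \<bullet> sgn (embed x)"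
proof -
  have "\<exists>a N. free a \<and> 2 ^ N \<le> norm (embed x) \<and>
      cos (\<Sum>n<N. arcsin (2 * r * (1/2) ^ n)) \<le> sgn (embed a) \<bullet> sgn (embed x)"
    using assms
  proof (induction "nat \<lfloor>norm (embed x)\<rfloor>" arbitrary: x rule: less_induct)
    case (less x)
    show ?case
    proof (cases "free x")
      case True
      have "sgn (embed x) \<bullet> sgn (embed x) = 1"
        using less.prems by (simp add: dot_square_norm norm_sgn)
      then show ?thesis
        using True less.prems norm_embed_ge_1[of x] by (intro exI[of _ x] exI[of _ 0]) simp
    next
      case False
      then obtain k where k: "obstacle_between B k 0 x"
        using less.prems unfolding free_def by blast
      then have kx: "k \<noteq> 0" "k \<noteq> x"
        unfolding obstacle_between_def by auto
      obtain t where t: "0 \<le> t" "t \<le> 1" "norm (embed k - t *\<^sub>R embed x) \<le> 2 * r"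
        using k by (rule between_near_chord) simp
      have "\<exists>y t. y \<noteq> 0 \<and> y \<noteq> x \<and> norm (embed y) \<le> norm (embed (x - y)) \<and> 0 \<le> t \<and> t \<le> 1
          \<and> norm (embed y - t *\<^sub>R embed x) \<le> 2 * r"
      proof (cases "norm (embed k) \<le> norm (embed (x - k))")
        case True
        then show ?thesis
          using kx t by blast
      next
        case False
        have "embed (x - k) - (1 - t) *\<^sub>R embed x = - (embed k - t *\<^sub>R embed x)"
          by (simp add: algebra_simps)
        then have "norm (embed (x - k) - (1 - t) *\<^sub>R embed x) \<le> 2 * r"
          using t(3) by (metis norm_minus_cancel)
        then show ?thesis
          using kx t False by (intro exI[of _ "x - k"] exI[of _ "1 - t"]) auto
      qed
      then obtain y t where y: "y \<noteq> 0" "y \<noteq> x" "norm (embed y) \<le> norm (embed (x - y))"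
        and t: "0 \<le> t" "t \<le> 1" "norm (embed y - t *\<^sub>R embed x) \<le> 2 * r"
        by blast
      have half: "2 * norm (embed y) \<le> norm (embed x)"
        and angle: "cos (arcsin (2 * r / norm (embed y))) \<le> sgn (embed y) \<bullet> sgn (embed x)"
        using shorter_part[of y "x - y" t "2 * r"] y t two_r_sq by simp_all
      have y1: "1 \<le> norm (embed y)"
        using y(1) by (rule norm_embed_ge_1)
      have "norm (embed y) + 1 \<le> norm (embed x)"
        using half y1 by linarith
      then have "nat \<lfloor>norm (embed y)\<rfloor> < nat \<lfloor>norm (embed x)\<rfloor>"
        using y1 by linarith
      then obtain a N where a: "free a" "2 ^ N \<le> norm (embed y)"
          "cos (\<Sum>n<N. arcsin (2 * r * (1/2) ^ n)) \<le> sgn (embed a) \<bullet> sgn (embed y)"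
        using less.hyps y(1) by blast
      have "2 * r / norm (embed y) \<le> 2 * r / 2 ^ N"
        using a(2) r_nonneg y1 by (intro divide_left_mono mult_pos_pos) auto
      then have "2 * r / norm (embed y) \<le> 2 * r * (1/2) ^ N"
        by (simp add: power_one_over)
      moreover have "2 * r * (1/2) ^ N \<le> 1"
        using two_r_less_1 r_nonneg power_le_one[of "1/2 :: real" N] mult_mono[of "2 * r" 1 "(1/2) ^ N" 1]
        by simp
      moreover have "0 \<le> 2 * r / norm (embed y)"
        using r_nonneg by simp
      ultimately have arc: "arcsin (2 * r / norm (embed y)) \<le> arcsin (2 * r * (1/2) ^ N)"
          "0 \<le> arcsin (2 * r / norm (embed y))"
        by (auto intro!: arcsin_le_arcsin arcsin_nonneg)
      have le_pi: "(\<Sum>n<Suc N. arcsin (2 * r * (1/2) ^ n)) \<le> pi"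
        using partial_eta_le eta_le_pi order_trans by blast
      have nonneg: "0 \<le> (\<Sum>n<N. arcsin (2 * r * (1/2) ^ n))"
        using eta_term_bounds by (intro sum_nonneg) auto
      have "cos (arcsin (2 * r * (1/2) ^ N)) \<le> cos (arcsin (2 * r / norm (embed y)))"
        using arc le_pi nonneg by (intro cos_monotone_0_pi_le) auto
      with angle have "cos (arcsin (2 * r * (1/2) ^ N)) \<le> sgn (embed y) \<bullet> sgn (embed x)"
        by linarith
      then have "cos ((\<Sum>n<N. arcsin (2 * r * (1/2) ^ n)) + arcsin (2 * r * (1/2) ^ N))
          \<le> sgn (embed a) \<bullet> sgn (embed x)"
        using a y(1) less.prems nonneg eta_term_bounds(1)[of N] le_pi
        by (intro cos_add_le_inner[of _ "sgn (embed y)"]) (auto simp: norm_sgn free_def)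
      moreover have "2 ^ Suc N \<le> norm (embed x)"
        using half a(2) by simp
      ultimately show ?thesis
        using a(1) by (intro exI[of _ a] exI[of _ "Suc N"]) simp
    qed
  qed
  then obtain a N where a: "free a"
    "cos (\<Sum>n<N. arcsin (2 * r * (1/2) ^ n)) \<le> sgn (embed a) \<bullet> sgn (embed x)"
    by blast
  have "cos (eta r) \<le> cos (\<Sum>n<N. arcsin (2 * r * (1/2) ^ n))"
    using partial_eta_le eta_le_pi eta_term_bounds by (intro cos_monotone_0_pi_le sum_nonneg) auto
  then show ?thesis
    using that a by force
qed

text \<open>A point of the ball outside the closure could be separated from it strictly, in a direction \<open>u\<close>. But
  a free step nearly within the angle \<open>eta r\<close> of \<open>u\<close> provides an attainable velocity whose component
  along \<open>u\<close> is too large.\<close>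
lemma ball_subset_closure_attainable:
  "cball 0 ((1 - sqrt 2 / 2) * cos (eta r)) \<subseteq> closure attainable"
proof
  fix z :: "real ^ 'n"
  let ?R = "1 - sqrt 2 / 2"
  assume "z \<in> cball 0 (?R * cos (eta r))"
  then have z: "norm z \<le> ?R * cos (eta r)"
    by simp
  have R: "0 < ?R" "?R \<le> 1"
    using sqrt2_less_2 by simp_all
  show "z \<in> closure attainable"
  proof (rule ccontr)
    assume "z \<notin> closure attainable"
    then obtain v b where vb: "v \<bullet> z < b" "\<forall>x\<in>closure attainable. v \<bullet> x > b"
      using separating_hyperplane_closed_point[OF convex_closure[OF convex_attainable] closed_closure]
      by blast
    have "b < 0"
      using vb(2) zero_attainable closure_subset by fastforce
    then have "v \<noteq> 0"
      using vb(1) by auto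
    define u where "u = - sgn v"
    have u: "norm u = 1" "v = - norm v *\<^sub>R u"
      using \<open>v \<noteq> 0\<close> by (simp_all add: u_def norm_sgn sgn_div_norm)
    have vi: "v \<bullet> x = - norm v * (u \<bullet> x)" for x
      by (subst u(2)) simp
    define \<delta> where "\<delta> = (b - v \<bullet> z) / norm v"
    have \<delta>: "\<delta> > 0"
      using vb(1) \<open>v \<noteq> 0\<close> by (simp add: \<delta>_def)
    have sep: "u \<bullet> x < u \<bullet> z - \<delta>" if "x \<in> attainable" for x
    proof -
      have "b < v \<bullet> x"
        using vb(2) that closure_subset by blast
      then have "v \<bullet> z + \<delta> * norm v < v \<bullet> x"
        using \<open>v \<noteq> 0\<close> by (simp add: \<delta>_def)
      then have "norm v * (u \<bullet> x) < norm v * (u \<bullet> z - \<delta>)"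
        unfolding vi by (simp add: algebra_simps)
      then show ?thesis
        using \<open>v \<noteq> 0\<close> by simp
    qed
    obtain x where x: "x \<noteq> 0" "norm (sgn (embed x) - u) < \<delta>"
      using lattice_direction_near[OF u(1) \<delta>] .
    obtain a where a: "free a" "cos (eta r) \<le> sgn (embed a) \<bullet> sgn (embed x)"
      using free_direction_near_lattice_direction[OF x(1)] .
    have "sgn (embed a) \<bullet> (sgn (embed x) - u) \<le> norm (sgn (embed a)) * norm (sgn (embed x) - u)"
      by (rule norm_cauchy_schwarz)
    also have "\<dots> < \<delta>"
      using x(2) a(1) by (simp add: norm_sgn free_def)
    finally have "cos (eta r) - \<delta> < u \<bullet> sgn (embed a)"
      using a(2) by (simp add: inner_diff_right inner_commute)
    then have "?R * (cos (eta r) - \<delta>) < ?R * (u \<bullet> sgn (embed a))"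
      using R by (intro mult_strict_left_mono)
    also have "\<dots> = u \<bullet> (?R *\<^sub>R sgn (embed a))"
      by simp
    also have "\<dots> < u \<bullet> z - \<delta>"
      using sep attainable_free_direction[OF a(1)] by blast
    also have "u \<bullet> z \<le> ?R * cos (eta r)"
      using norm_cauchy_schwarz[of u z] u(1) z by simp
    finally have "?R * (cos (eta r) - \<delta>) < ?R * cos (eta r) - \<delta>"
      by simp
    then have "\<delta> < ?R * \<delta>"
      by (simp add: algebra_simps)
    also have "\<dots> \<le> 1 * \<delta>"
      using R \<delta> by (intro mult_right_mono) auto
    finally show False
      by simp
  qed
qed

end

theorem theorem4p10:
  fixes B :: "(real ^ 'n) set" and c :: "real ^ 'n" and r :: real
  assumes "CARD('n) \<ge> 2"
    and "obstacle B"
    and "B \<subseteq> cball c r"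
    and "r < sqrt 2 / 4"
  shows "cball 0 ((1 - sqrt 2 / 2) * cos (eta r)) \<subseteq> admissible_rotation_set B"
proof -
  interpret small_obstacle B c r
    using assms by unfold_locales
  show ?thesis
    using ball_subset_closure_attainable closure_attainable_subset by blast
qed

end
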